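(* Suppose that $P,P'$ are simple $\mathfrak{D}$-modules and $V,V'$ are simple $\mathfrak{b}$-modules such that there are $l,s\in\mathbb{Z}_{>0}$ for which $d_l$ acts injectively on $V$ and $d_iV=0$ for any $i>l$, and $d_s$ acts injectively on $V'$ and $d_iV'=0$ for any $i>s$. Then $T(P,V)\cong T(P',V')$ as $\mathfrak{W}$-modules if and only if $P\cong P'$ (as $\mathfrak{D}$-modules), $l=s$ and $V\cong V'$ (as $\mathfrak{b}$-modules).
   Context: All vector spaces and Lie algebras are over $\mathbb{C}$, and $\otimes=\otimes_{\mathbb{C}}$. Let $\mathfrak{W}=\mathrm{Der}_{\mathbb{C}}\,\mathbb{C}[x]$, the Lie algebra with basis $d_i=x^{i+1}\frac{\partial}{\partial x}$, $i\in\mathbb{Z}_{\ge -1}$, and bracket $[d_i,d_j]=(j-i)d_{i+j}$. Let $\mathfrak{b}=\mathrm{span}\{d_i\mid i\in\mathbb{Z}_{\ge 0}\}$, a Lie subalgebra of $\mathfrak{W}$. Let $\mathfrak{D}$ be the Weyl algebra of rank one, i.e. the associative $\mathbb{C}$-algebra generated by $x,\partial$ subject to the relation $[\partial,x]=1$. There is an (injective) algebra homomorphism $\phi:U(\mathfrak{W})\to\mathfrak{D}\otimes U(\mathfrak{b})$ with $$d_{-1}\mapsto\partial\otimes1,\qquad d_m\mapsto x^{m+1}\partial\otimes1+\sum_{r=0}^m\binom{m+1}{r+1}x^{m-r}\otimes d_r\quad(m\in\mathbb{Z}_{\ge0}).$$ For a $\mathfrak{D}$-module $P$ and a $\mathfrak{b}$-module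 $V$, $T(P,V)$ denotes the vector space $P\otimes V$ regarded as a $\mathfrak{W}$-module via $\phi$. *)

theory Defs
  imports Complex_Main "HOL-Library.Poly_Mapping" "HOL-Computational_Algebra.Polynomial"
begin

section \<open>Complex vector spaces and algebras\<close>

class complex_vector = ab_group_add +
  fixes scaleC :: "complex \<Rightarrow> 'a \<Rightarrow> 'a"  (infixr \<open>*\<^sub>C\<close> 75)
  assumes scaleC_add_right: "c *\<^sub>C (x + y) = c *\<^sub>C x + c *\<^sub>C y"
    and scaleC_add_left: "(c + d) *\<^sub>C x = c *\<^sub>C x + d *\<^sub>C x"
    and scaleC_scaleC: "c *\<^sub>C d *\<^sub>C x = (c * d) *\<^sub>C x"
    and scaleC_one: "1 *\<^sub>C x = x"

global_interpretation complex_vector: vector_space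
  "scaleC :: complex \<Rightarrow> 'a \<Rightarrow> 'a::complex_vector"
  by unfold_locales (simp_all add: scaleC_add_right scaleC_add_left scaleC_scaleC scaleC_one)

global_interpretation complex_vector: vector_space_pair
  "scaleC :: complex \<Rightarrow> 'a \<Rightarrow> 'a::complex_vector" "scaleC :: complex \<Rightarrow> 'b \<Rightarrow> 'b::complex_vector"
  by unfold_locales

abbreviation clinear :: "('a::complex_vector \<Rightarrow> 'b::complex_vector) \<Rightarrow> bool" where
  "clinear \<equiv> Vector_Spaces.linear scaleC scaleC"

abbreviation cspan :: "'a::complex_vector set \<Rightarrow> 'a set" where
  "cspan \<equiv> complex_vector.span"

abbreviation csubspace :: "'a::complex_vector set \<Rightarrow> bool" where
  "csubspace \<equiv> complex_vector.subspace"

lemma clinearI: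
  assumes "\<And>x y. f (x + y) = f x + f y" "\<And>c x. f (c *\<^sub>C x) = c *\<^sub>C f x"
  shows "clinear f"
  using assms by unfold_locales auto

lemma clinear_add: "clinear f \<Longrightarrow> f (x + y) = f x + f y"
  and clinear_scale: "clinear f \<Longrightarrow> f (c *\<^sub>C x) = c *\<^sub>C f x"
  and clinear_diff: "clinear f \<Longrightarrow> f (x - y) = f x - f y"
  and clinear_zero: "clinear f \<Longrightarrow> f 0 = 0"
  and clinear_neg: "clinear f \<Longrightarrow> f (- x) = - f x"
  by (auto simp: complex_vector.linear_add complex_vector.linear_scale
      complex_vector.linear_diff complex_vector.linear_0 complex_vector.linear_neg)

class complex_algebra_1 = complex_vector + ring_1 +
  assumes mult_scaleC_left: "(c *\<^sub>C x) * y = c *\<^sub>C (x * y)"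
    and mult_scaleC_right: "x * (c *\<^sub>C y) = c *\<^sub>C (x * y)"

instantiation complex :: complex_algebra_1
begin
definition scaleC_complex_def [simp]: "scaleC (c::complex) x = c * x"
instance by standard (simp_all add: algebra_simps)
end

class lie_algebra = complex_vector +
  fixes lie_bracket :: "'a \<Rightarrow> 'a \<Rightarrow> 'a"
  assumes lie_bracket_add_left: "lie_bracket (x + y) z = lie_bracket x z + lie_bracket y z"
    and lie_bracket_add_right: "lie_bracket z (x + y) = lie_bracket z x + lie_bracket z y"
    and lie_bracket_scale_left: "lie_bracket (c *\<^sub>C x) y = c *\<^sub>C lie_bracket x y"
    and lie_bracket_scale_right: "lie_bracket x (c *\<^sub>C y) = c *\<^sub>C lie_bracket x y"
    and lie_bracket_self: "lie_bracket x x = 0"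
    and lie_bracket_jacobi:
      "lie_bracket x (lie_bracket y z) + lie_bracket y (lie_bracket z x)
        + lie_bracket z (lie_bracket x y) = 0"


section \<open>Modules\<close>

definition algebra_module :: "('r::complex_algebra_1 \<Rightarrow> 'm::complex_vector \<Rightarrow> 'm) \<Rightarrow> bool" where
  "algebra_module \<alpha> \<longleftrightarrow>
     (\<forall>a. clinear (\<alpha> a)) \<and>
     (\<forall>a b m. \<alpha> (a + b) m = \<alpha> a m + \<alpha> b m) \<and>
     (\<forall>c a m. \<alpha> (c *\<^sub>C a) m = c *\<^sub>C \<alpha> a m) \<and>
     (\<forall>m. \<alpha> 1 m = m) \<and>
     (\<forall>a b m. \<alpha> (a * b) m = \<alpha> a (\<alpha> b m))"

text \<open>Modules over a Lie subalgebra \<open>L\<close>; the values of \<open>\<rho>\<close> outside \<open>L\<close> are irrelevant.\<close>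

definition lie_module ::
  "'g::lie_algebra set \<Rightarrow> ('g \<Rightarrow> 'm::complex_vector \<Rightarrow> 'm) \<Rightarrow> bool" where
  "lie_module L \<rho> \<longleftrightarrow>
     (\<forall>a\<in>L. clinear (\<rho> a)) \<and>
     (\<forall>a\<in>L. \<forall>b\<in>L. \<forall>m. \<rho> (a + b) m = \<rho> a m + \<rho> b m) \<and>
     (\<forall>c. \<forall>a\<in>L. \<forall>m. \<rho> (c *\<^sub>C a) m = c *\<^sub>C \<rho> a m) \<and>
     (\<forall>a\<in>L. \<forall>b\<in>L. \<forall>m. \<rho> (lie_bracket a b) m = \<rho> a (\<rho> b m) - \<rho> b (\<rho> a m))"

text \<open>
  The following notions apply to modules over an algebra as well as over a Lie algebra;
  \<open>S\<close> is the set of acting elements.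
\<close>

definition submodule :: "'r set \<Rightarrow> ('r \<Rightarrow> 'm::complex_vector \<Rightarrow> 'm) \<Rightarrow> 'm set \<Rightarrow> bool" where
  "submodule S \<alpha> N \<longleftrightarrow> csubspace N \<and> (\<forall>a\<in>S. \<forall>n\<in>N. \<alpha> a n \<in> N)"

definition simple_module :: "'r set \<Rightarrow> ('r \<Rightarrow> 'm::complex_vector \<Rightarrow> 'm) \<Rightarrow> bool" where
  "simple_module S \<alpha> \<longleftrightarrow>
     (UNIV :: 'm set) \<noteq> {0} \<and> (\<forall>N. submodule S \<alpha> N \<longrightarrow> N = {0} \<or> N = UNIV)"

definition module_isomorphic ::
  "'r set \<Rightarrow> ('r \<Rightarrow> 'm::complex_vector \<Rightarrow> 'm) \<Rightarrow> ('r \<Rightarrow> 'n::complex_vector \<Rightarrow> 'n) \<Rightarrow> bool" where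
  "module_isomorphic S \<alpha> \<beta> \<longleftrightarrow>
     (\<exists>f. clinear f \<and> bij f \<and> (\<forall>a\<in>S. \<forall>m. f (\<alpha> a m) = \<beta> a (f m)))"


section \<open>Free vector spaces and free algebras\<close>

instantiation poly_mapping :: (type, complex_vector) complex_vector
begin
definition scaleC_poly_mapping :: "complex \<Rightarrow> ('a \<Rightarrow>\<^sub>0 'b) \<Rightarrow> 'a \<Rightarrow>\<^sub>0 'b" where
  "scaleC_poly_mapping c p = Poly_Mapping.map (scaleC c) p"

instance
proof
  have l: "Poly_Mapping.lookup (c *\<^sub>C p) k = c *\<^sub>C Poly_Mapping.lookup p k" for c and p :: "'a \<Rightarrow>\<^sub>0 'b" and k
    unfolding scaleC_poly_mapping_def by transfer (simp add: when_def)
  fix c d :: complex and x y :: "'a \<Rightarrow>\<^sub>0 'b"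
  show "c *\<^sub>C (x + y) = c *\<^sub>C x + c *\<^sub>C y" "(c + d) *\<^sub>C x = c *\<^sub>C x + d *\<^sub>C x"
    "c *\<^sub>C d *\<^sub>C x = (c * d) *\<^sub>C x" "1 *\<^sub>C x = x"
    by (intro poly_mapping_eqI; simp add: l lookup_add scaleC_add_left scaleC_add_right
        scaleC_scaleC scaleC_one)+
qed
end

lemma lookup_scaleC [simp]: "Poly_Mapping.lookup (c *\<^sub>C p) k = c *\<^sub>C Poly_Mapping.lookup p k"
  unfolding scaleC_poly_mapping_def by transfer (simp add: when_def)

lemma scaleC_single: "c *\<^sub>C Poly_Mapping.single k x = Poly_Mapping.single k (c *\<^sub>C x)"
  by (intro poly_mapping_eqI) (simp add: lookup_single when_def)

lemma poly_mapping_single_induct [case_names single add]: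
  assumes single: "\<And>k c. Q (Poly_Mapping.single k c)"
    and add: "\<And>p q. Q p \<Longrightarrow> Q q \<Longrightarrow> Q (p + q)"
  shows "Q (p :: 'a \<Rightarrow>\<^sub>0 'b::ab_group_add)"
proof (induction p rule: update_induct)
  case const
  show ?case using single[of undefined 0] by simp
next
  case (update p a b)
  have "Poly_Mapping.update a b p = p + Poly_Mapping.single a b"
    using update(1)
    by (intro poly_mapping_eqI) (auto simp: lookup_update lookup_add lookup_single when_def in_keys_iff)
  then show ?case using update(3) single add by metis
qed

instance poly_mapping :: (monoid_add, complex_algebra_1) complex_algebra_1
proof
  fix c :: complex and x y :: "'a \<Rightarrow>\<^sub>0 'b"
  show "(c *\<^sub>C x) * y = c *\<^sub>C (x * y)"
  proof (induction x rule: poly_mapping_single_induct)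
    case (single k a)
    show ?case
      by (induction y rule: poly_mapping_single_induct)
        (simp_all add: scaleC_single mult_single mult_scaleC_left distrib_left scaleC_add_right)
  qed (simp add: distrib_right scaleC_add_right)
  show "x * (c *\<^sub>C y) = c *\<^sub>C (x * y)"
  proof (induction x rule: poly_mapping_single_induct)
    case (single k a)
    show ?case
      by (induction y rule: poly_mapping_single_induct)
        (simp_all add: scaleC_single mult_single mult_scaleC_right distrib_left scaleC_add_right)
  qed (simp add: distrib_right scaleC_add_right)
qed

text \<open>The linear extension of a map on basis elements to the free vector space.\<close>

definition free_lift :: "('a \<Rightarrow> 'b::complex_vector) \<Rightarrow> ('a \<Rightarrow>\<^sub>0 complex) \<Rightarrow> 'b" where
  "free_lift f p = (\<Sum>k\<in>Poly_Mapping.keys p. Poly_Mapping.lookup p k *\<^sub>C f k)"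

lemma free_lift_superset:
  assumes "finite A" "Poly_Mapping.keys p \<subseteq> A"
  shows "free_lift f p = (\<Sum>k\<in>A. Poly_Mapping.lookup p k *\<^sub>C f k)"
  unfolding free_lift_def
  by (rule sum.mono_neutral_left) (use assms in \<open>auto simp: in_keys_iff\<close>)

lemma free_lift_single [simp]: "free_lift f (Poly_Mapping.single k c) = c *\<^sub>C f k"
  by (subst free_lift_superset[of "{k}"]) (auto simp: lookup_single split: if_splits)

lemma clinear_free_lift: "clinear (free_lift f)"
proof (rule clinearI)
  fix p q :: "'a \<Rightarrow>\<^sub>0 complex" and c
  let ?A = "Poly_Mapping.keys p \<union> Poly_Mapping.keys q"
  have "Poly_Mapping.keys (p + q) \<subseteq> ?A" by (rule Poly_Mapping.keys_add)
  then show "free_lift f (p + q) = free_lift f p + free_lift f q"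
    by (subst (1 2 3) free_lift_superset[of ?A])
      (auto simp: lookup_add scaleC_add_left sum.distrib)
  have "Poly_Mapping.keys (c *\<^sub>C p) \<subseteq> Poly_Mapping.keys p" by (auto simp: in_keys_iff)
  then show "free_lift f (c *\<^sub>C p) = c *\<^sub>C free_lift f p"
    by (subst (1 2) free_lift_superset[of "Poly_Mapping.keys p"])
      (auto simp: complex_vector.scale_sum_right)
qed


section \<open>The tensor product over the complex numbers\<close>

definition tensor_relations :: "('a::complex_vector \<times> 'b::complex_vector \<Rightarrow>\<^sub>0 complex) set" where
  "tensor_relations =
     {Poly_Mapping.single (a + a', b) 1 - Poly_Mapping.single (a, b) 1
        - Poly_Mapping.single (a', b) 1 | a a' b. True} \<union>
     {Poly_Mapping.single (a, b + b') 1 - Poly_Mapping.single (a, b) 1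
        - Poly_Mapping.single (a, b') 1 | a b b'. True} \<union>
     {Poly_Mapping.single (c *\<^sub>C a, b) 1 - c *\<^sub>C Poly_Mapping.single (a, b) 1 | c a b. True} \<union>
     {Poly_Mapping.single (a, c *\<^sub>C b) 1 - c *\<^sub>C Poly_Mapping.single (a, b) 1 | c a b. True}"

lemma equivp_mod_span: "equivp (\<lambda>x y. x - y \<in> cspan S)"
proof (rule equivpI)
  show "reflp (\<lambda>x y. x - y \<in> cspan S)"
    by (rule reflpI) (simp add: complex_vector.span_zero)
  show "symp (\<lambda>x y. x - y \<in> cspan S)"
    by (rule sympI) (metis complex_vector.span_neg minus_diff_eq)
  show "transp (\<lambda>x y. x - y \<in> cspan S)"
    by (rule transpI) (metis complex_vector.span_add diff_add_cancel add_diff_eq)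
qed

quotient_type (overloaded) ('a, 'b) tensor =
  "'a::complex_vector \<times> 'b::complex_vector \<Rightarrow>\<^sub>0 complex" /
  "\<lambda>x y. x - y \<in> cspan tensor_relations"
  by (rule equivp_mod_span)

lemma mod_span_add:
  "x - x' \<in> cspan S \<Longrightarrow> y - y' \<in> cspan S \<Longrightarrow> (x + y) - (x' + y') \<in> cspan S"
  using complex_vector.span_add[of "x - x'" S "y - y'"] by (simp add: algebra_simps)

lemma mod_span_diff:
  "x - x' \<in> cspan S \<Longrightarrow> y - y' \<in> cspan S \<Longrightarrow> (x - y) - (x' - y') \<in> cspan S"
  using complex_vector.span_diff[of "x - x'" S "y - y'"] by (simp add: algebra_simps)

lemma mod_span_neg: "x - x' \<in> cspan S \<Longrightarrow> - x - - x' \<in> cspan S"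
  using complex_vector.span_neg[of "x - x'" S] by (simp add: algebra_simps)

lemma mod_span_scale: "x - x' \<in> cspan S \<Longrightarrow> c *\<^sub>C x - c *\<^sub>C x' \<in> cspan S"
  using complex_vector.span_scale[of "x - x'" S c] by (simp add: complex_vector.scale_right_diff_distrib)

instantiation tensor :: (complex_vector, complex_vector) complex_vector
begin
lift_definition zero_tensor :: "('a, 'b) tensor" is 0 .
lift_definition plus_tensor :: "('a, 'b) tensor \<Rightarrow> ('a, 'b) tensor \<Rightarrow> ('a, 'b) tensor" is "(+)"
  by (rule mod_span_add)
lift_definition minus_tensor :: "('a, 'b) tensor \<Rightarrow> ('a, 'b) tensor \<Rightarrow> ('a, 'b) tensor" is "(-)"
  by (rule mod_span_diff)
lift_definition uminus_tensor :: "('a, 'b) tensor \<Rightarrow> ('a, 'b) tensor" is uminus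
  by (rule mod_span_neg)
lift_definition scaleC_tensor :: "complex \<Rightarrow> ('a, 'b) tensor \<Rightarrow> ('a, 'b) tensor" is scaleC
  by (rule mod_span_scale)
instance
  by standard (transfer; simp add: scaleC_add_left scaleC_add_right scaleC_scaleC scaleC_one
      complex_vector.span_zero algebra_simps)+
end

lift_definition tensor_of :: "'a::complex_vector \<Rightarrow> 'b::complex_vector \<Rightarrow> ('a, 'b) tensor"
    (infixr \<open>\<otimes>\<^sub>t\<close> 70)
  is "\<lambda>a b. Poly_Mapping.single (a, b) 1" .

definition bilinear_map ::
  "('a::complex_vector \<Rightarrow> 'b::complex_vector \<Rightarrow> 'c::complex_vector) \<Rightarrow> bool" where
  "bilinear_map f \<longleftrightarrow> (\<forall>b. clinear (\<lambda>a. f a b)) \<and> (\<forall>a. clinear (f a))"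

lemma bilinear_tensor_of: "bilinear_map (\<otimes>\<^sub>t)"
  unfolding bilinear_map_def
proof (intro conjI allI clinearI)
  fix a a' :: 'a and b b' :: 'b and c
  have base: "x \<in> tensor_relations \<Longrightarrow> x \<in> cspan tensor_relations"
    for x :: "'a \<times> 'b \<Rightarrow>\<^sub>0 complex"
    by (rule complex_vector.span_base)
  show "(a + a') \<otimes>\<^sub>t b = a \<otimes>\<^sub>t b + a' \<otimes>\<^sub>t b"
    by transfer (rule base, simp add: tensor_relations_def diff_diff_eq, blast)
  show "(c *\<^sub>C a) \<otimes>\<^sub>t b = c *\<^sub>C (a \<otimes>\<^sub>t b)"
    by transfer (rule base, simp add: tensor_relations_def, blast)
  show "a \<otimes>\<^sub>t (b + b') = a \<otimes>\<^sub>t b + a \<otimes>\<^sub>t b'"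
    by transfer (rule base, simp add: tensor_relations_def diff_diff_eq, blast)
  show "a \<otimes>\<^sub>t (c *\<^sub>C b) = c *\<^sub>C (a \<otimes>\<^sub>t b)"
    by transfer (rule base, simp add: tensor_relations_def, blast)
qed

lemma tensor_of_add_left: "(a + a') \<otimes>\<^sub>t b = a \<otimes>\<^sub>t b + a' \<otimes>\<^sub>t b"
  and tensor_of_add_right: "a \<otimes>\<^sub>t (b + b') = a \<otimes>\<^sub>t b + a \<otimes>\<^sub>t b'"
  and tensor_of_scale_left: "(c *\<^sub>C a) \<otimes>\<^sub>t b = c *\<^sub>C (a \<otimes>\<^sub>t b)"
  and tensor_of_scale_right: "a \<otimes>\<^sub>t (c *\<^sub>C b) = c *\<^sub>C (a \<otimes>\<^sub>t b)"
  using bilinear_tensor_of clinear_add[of "\<lambda>a. a \<otimes>\<^sub>t b" a a'] clinear_scale[of "\<lambda>a. a \<otimes>\<^sub>t b" c a]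
    clinear_add[of "(\<otimes>\<^sub>t) a" b b'] clinear_scale[of "(\<otimes>\<^sub>t) a" c b]
  unfolding bilinear_map_def by blast+

lemma tensor_induct [case_names tensor_of add]:
  assumes tensor_of: "\<And>a b. Q (a \<otimes>\<^sub>t b)" and add: "\<And>s t. Q s \<Longrightarrow> Q t \<Longrightarrow> Q (s + t)"
  shows "Q (t :: ('a::complex_vector, 'b::complex_vector) tensor)"
proof (induction t rule: tensor.abs_induct)
  case (1 p)
  show ?case
  proof (induction p rule: poly_mapping_single_induct)
    case (single k c)
    obtain a b where k: "k = (a, b)" by (cases k)
    have "abs_tensor (Poly_Mapping.single k c) = c *\<^sub>C (a \<otimes>\<^sub>t b)"
      by (simp add: k tensor_of.abs_eq scaleC_tensor.abs_eq scaleC_single)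
    also have "\<dots> = (c *\<^sub>C a) \<otimes>\<^sub>t b"
      by (simp add: tensor_of_scale_left)
    finally show ?case using tensor_of by simp
  next
    case (add p q)
    then show ?case using assms(2) by (metis plus_tensor.abs_eq)
  qed
qed

lemma tensor_universal:
  assumes f: "bilinear_map f"
  shows "\<exists>!h. clinear h \<and> (\<forall>a b. h (a \<otimes>\<^sub>t b) = f a b)"
proof -
  let ?F = "free_lift (\<lambda>(a, b). f a b)"
  have lin: "clinear ?F" by (rule clinear_free_lift)
  note f' = f[unfolded bilinear_map_def]
  have "?F x = 0" if "x \<in> tensor_relations" for x
    using that f' clinear_add[of "\<lambda>a. f a _"] clinear_scale[of "\<lambda>a. f a _"]
    by (auto simp: tensor_relations_def clinear_diff[OF lin] clinear_scale[OF lin] scaleC_one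
        clinear_add clinear_scale)
  then have kill: "?F x = 0" if "x \<in> cspan tensor_relations" for x
    using complex_vector.linear_eq_0_on_span[OF lin _ that] by blast
  define h where "h t = ?F (rep_tensor t)" for t
  have h: "h (abs_tensor p) = ?F p" for p
  proof -
    have "abs_tensor (rep_tensor (abs_tensor p)) = abs_tensor p"
      by (rule Quotient_abs_rep[OF Quotient_tensor])
    then have "rep_tensor (abs_tensor p) - p \<in> cspan tensor_relations"
      by (simp add: tensor.abs_eq_iff)
    from kill[OF this] show ?thesis by (simp add: h_def clinear_diff[OF lin])
  qed
  have "clinear h"
  proof (rule clinearI)
    fix s t c
    show "h (s + t) = h s + h t"
      by (induction s rule: tensor.abs_induct, induction t rule: tensor.abs_induct)
        (simp add: plus_tensor.abs_eq h clinear_add[OF lin])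
    show "h (c *\<^sub>C s) = c *\<^sub>C h s"
      by (induction s rule: tensor.abs_induct)
        (simp add: scaleC_tensor.abs_eq h clinear_scale[OF lin])
  qed
  moreover have "h (a \<otimes>\<^sub>t b) = f a b" for a b
    by (simp add: tensor_of.abs_eq h scaleC_one)
  moreover have "h1 = h2" if "clinear h1" "clinear h2" "\<And>a b. h1 (a \<otimes>\<^sub>t b) = f a b"
    "\<And>a b. h2 (a \<otimes>\<^sub>t b) = f a b" for h1 h2
  proof
    fix t show "h1 t = h2 t"
      by (induction t rule: tensor_induct) (use that in \<open>auto simp: clinear_add\<close>)
  qed
  ultimately show ?thesis by blast
qed

text \<open>The operator \<open>A \<otimes> B\<close> on the tensor product, for linear \<open>A\<close> and \<open>B\<close>.\<close>

definition tensor_map ::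
  "('a::complex_vector \<Rightarrow> 'c::complex_vector) \<Rightarrow> ('b::complex_vector \<Rightarrow> 'd::complex_vector)
     \<Rightarrow> ('a, 'b) tensor \<Rightarrow> ('c, 'd) tensor" where
  "tensor_map A B = (THE h. clinear h \<and> (\<forall>a b. h (a \<otimes>\<^sub>t b) = A a \<otimes>\<^sub>t B b))"

lemma
  assumes "clinear A" "clinear B"
  shows clinear_tensor_map: "clinear (tensor_map A B)"
    and tensor_map_tensor_of: "tensor_map A B (a \<otimes>\<^sub>t b) = A a \<otimes>\<^sub>t B b"
proof -
  have "bilinear_map (\<lambda>a b. A a \<otimes>\<^sub>t B b)"
    unfolding bilinear_map_def
    by (intro conjI allI clinearI)
      (simp_all only: clinear_add[OF assms(1)] clinear_add[OF assms(2)] clinear_scale[OF assms(1)]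
        clinear_scale[OF assms(2)] tensor_of_add_left tensor_of_add_right tensor_of_scale_left
        tensor_of_scale_right)
  from theI'[OF tensor_universal[OF this]]
  have "clinear (tensor_map A B) \<and> (\<forall>a b. tensor_map A B (a \<otimes>\<^sub>t b) = A a \<otimes>\<^sub>t B b)"
    unfolding tensor_map_def .
  then show "clinear (tensor_map A B)" "tensor_map A B (a \<otimes>\<^sub>t b) = A a \<otimes>\<^sub>t B b"
    by simp_all
qed


section \<open>The Weyl algebra of rank one\<close>

datatype weyl_letter = Letter_x | Letter_d

datatype weyl_word = Word "weyl_letter list"

instantiation weyl_word :: monoid_add
begin
definition zero_weyl_word :: weyl_word where "0 = Word []"
fun plus_weyl_word :: "weyl_word \<Rightarrow> weyl_word \<Rightarrow> weyl_word" where
  "Word u + Word v = Word (u @ v)"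
instance
proof
  fix a b c :: weyl_word
  show "a + b + c = a + (b + c)" by (cases a; cases b; cases c) simp
  show "0 + a = a" "a + 0 = a" by (cases a; simp add: zero_weyl_word_def)+
qed
end

text \<open>
  The type \<^typ>\<open>weyl_word \<Rightarrow>\<^sub>0 complex\<close>, with the convolution product, is the free associative
  algebra on the two letters. The span below is the two-sided ideal generated by
  \<open>\<partial> x - x \<partial> - 1\<close>.
\<close>

definition free_letter :: "weyl_letter \<Rightarrow> (weyl_word \<Rightarrow>\<^sub>0 complex)" where
  "free_letter z = Poly_Mapping.single (Word [z]) 1"

definition weyl_relator :: "weyl_word \<Rightarrow>\<^sub>0 complex" where
  "weyl_relator = free_letter Letter_d * free_letter Letter_x
     - free_letter Letter_x * free_letter Letter_d - 1"

definition weyl_ideal_generators :: "(weyl_word \<Rightarrow>\<^sub>0 complex) set" where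
  "weyl_ideal_generators = {u * weyl_relator * v | u v. True}"

quotient_type weyl = "weyl_word \<Rightarrow>\<^sub>0 complex" / "\<lambda>x y. x - y \<in> cspan weyl_ideal_generators"
  by (rule equivp_mod_span)

lemma weyl_ideal_mult_left:
  assumes "x \<in> cspan weyl_ideal_generators"
  shows "u * x \<in> cspan weyl_ideal_generators"
proof -
  have lin: "clinear (\<lambda>x. u * x)"
    by (rule clinearI) (simp_all add: distrib_left mult_scaleC_right)
  have "(\<lambda>x. u * x) ` weyl_ideal_generators \<subseteq> weyl_ideal_generators"
    by (auto simp: weyl_ideal_generators_def) (metis mult.assoc)
  then show ?thesis
    using assms complex_vector.linear_span_image[OF lin, of weyl_ideal_generators]
      complex_vector.span_mono by blast
qed

lemma weyl_ideal_mult_right: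
  assumes "x \<in> cspan weyl_ideal_generators"
  shows "x * u \<in> cspan weyl_ideal_generators"
proof -
  have lin: "clinear (\<lambda>x. x * u)"
    by (rule clinearI) (simp_all add: distrib_right mult_scaleC_left)
  have "(\<lambda>x. x * u) ` weyl_ideal_generators \<subseteq> weyl_ideal_generators"
    by (auto simp: weyl_ideal_generators_def) (metis mult.assoc)
  then show ?thesis
    using assms complex_vector.linear_span_image[OF lin, of weyl_ideal_generators]
      complex_vector.span_mono by blast
qed

text \<open>The ideal is proper, because the free algebra acts on polynomials through its quotient.\<close>

instantiation poly :: (complex_vector) complex_vector
begin
definition scaleC_poly :: "complex \<Rightarrow> 'a poly \<Rightarrow> 'a poly" where
  "scaleC_poly c p = map_poly (scaleC c) p"
instance
  by standard (auto intro!: poly_eqI simp: scaleC_poly_def coeff_map_poly scaleC_add_left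
      scaleC_add_right scaleC_scaleC scaleC_one)
end

lemma scaleC_poly_eq_smult: "c *\<^sub>C (p :: complex poly) = smult c p"
  by (intro poly_eqI) (simp add: scaleC_poly_def coeff_map_poly)

fun letter_op :: "weyl_letter \<Rightarrow> complex poly \<Rightarrow> complex poly" where
  "letter_op Letter_x f = [:0, 1:] * f"
| "letter_op Letter_d f = pderiv f"

fun word_op :: "weyl_word \<Rightarrow> complex poly \<Rightarrow> complex poly" where
  "word_op (Word u) f = foldr letter_op u f"

definition free_op :: "(weyl_word \<Rightarrow>\<^sub>0 complex) \<Rightarrow> complex poly \<Rightarrow> complex poly" where
  "free_op p f = free_lift (\<lambda>w. word_op w f) p"

lemma clinear_free_op: "clinear (\<lambda>p. free_op p f)"
  unfolding free_op_def by (rule clinear_free_lift)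

lemma clinear_word_op: "clinear (word_op w)"
proof (cases w)
  case (Word u)
  have "clinear (foldr letter_op u)"
  proof (induction u)
    case Nil
    show ?case by (auto intro!: clinearI)
  next
    case (Cons z u)
    have z: "clinear (letter_op z)"
      by (cases z) (auto intro!: clinearI
          simp: distrib_left scaleC_poly_eq_smult pderiv_add pderiv_smult smult_add_right)
    show ?case
      by (auto intro!: clinearI simp: z[THEN clinear_add] z[THEN clinear_scale]
          Cons[THEN clinear_add] Cons[THEN clinear_scale])
  qed
  then show ?thesis
    unfolding Word by (auto intro!: clinearI dest: clinear_add clinear_scale)
qed

lemma free_op_single: "free_op (Poly_Mapping.single w c) f = c *\<^sub>C word_op w f"
  by (simp add: free_op_def)

lemma clinear_free_op2: "clinear (free_op p)"
proof (induction p rule: poly_mapping_single_induct)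
  case (single w c)
  show ?case
    by (rule clinearI) (simp_all add: free_op_single clinear_add[OF clinear_word_op]
        clinear_scale[OF clinear_word_op] scaleC_add_right scaleC_scaleC mult.commute)
next
  case (add p q)
  show ?case
    by (rule clinearI) (simp_all add: clinear_add[OF clinear_free_op] add[THEN clinear_add]
        add[THEN clinear_scale] scaleC_add_right)
qed

lemma free_op_mult: "free_op (p * q) f = free_op p (free_op q f)"
proof (induction p rule: poly_mapping_single_induct)
  case (single w c)
  show ?case
  proof (induction q rule: poly_mapping_single_induct)
    case (single w' c')
    have "word_op (w + w') f = word_op w (word_op w' f)"
      by (cases w; cases w') simp
    then show ?case
      by (simp add: mult_single free_op_single clinear_scale[OF clinear_word_op] scaleC_scaleC)
  qed (simp add: distrib_left clinear_add[OF clinear_free_op] clinear_add[OF clinear_free_op2])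
qed (simp add: distrib_right clinear_add[OF clinear_free_op])

lemma free_op_one [simp]: "free_op 1 f = f"
proof -
  have "(1 :: weyl_word \<Rightarrow>\<^sub>0 complex) = Poly_Mapping.single (Word []) 1"
    by (simp add: zero_weyl_word_def[symmetric])
  then show ?thesis by (metis free_op_single scaleC_one word_op.simps foldr.simps(1) id_apply)
qed

lemma free_op_weyl_relator: "free_op weyl_relator f = 0"
  by (simp add: weyl_relator_def free_letter_def clinear_diff[OF clinear_free_op] free_op_mult
      free_op_single scaleC_one pderiv_pCons)

lemma one_notin_weyl_ideal: "1 \<notin> cspan weyl_ideal_generators"
proof
  assume *: "1 \<in> cspan weyl_ideal_generators"
  have "free_op x f = 0" if "x \<in> weyl_ideal_generators" for x f
    using that by (auto simp: weyl_ideal_generators_def free_op_mult free_op_weyl_relator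
        clinear_zero[OF clinear_free_op2])
  then have "free_op 1 f = 0" for f
    using complex_vector.linear_eq_0_on_span[OF clinear_free_op _ *] by blast
  from this[of 1] show False by simp
qed

instantiation weyl :: complex_algebra_1
begin
lift_definition zero_weyl :: weyl is 0 .
lift_definition one_weyl :: weyl is 1 .
lift_definition plus_weyl :: "weyl \<Rightarrow> weyl \<Rightarrow> weyl" is "(+)"
  by (rule mod_span_add)
lift_definition minus_weyl :: "weyl \<Rightarrow> weyl \<Rightarrow> weyl" is "(-)"
  by (rule mod_span_diff)
lift_definition uminus_weyl :: "weyl \<Rightarrow> weyl" is uminus
  by (rule mod_span_neg)
lift_definition scaleC_weyl :: "complex \<Rightarrow> weyl \<Rightarrow> weyl" is scaleC
  by (rule mod_span_scale)
lift_definition times_weyl :: "weyl \<Rightarrow> weyl \<Rightarrow> weyl" is "(*)"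
proof -
  fix x x' y y' :: "weyl_word \<Rightarrow>\<^sub>0 complex"
  assume "x - x' \<in> cspan weyl_ideal_generators" "y - y' \<in> cspan weyl_ideal_generators"
  then have "(x - x') * y + x' * (y - y') \<in> cspan weyl_ideal_generators"
    by (intro complex_vector.span_add weyl_ideal_mult_left weyl_ideal_mult_right)
  then show "x * y - x' * y' \<in> cspan weyl_ideal_generators"
    by (simp add: algebra_simps)
qed
instance
proof
  show "(0::weyl) \<noteq> 1"
  proof (transfer, rule notI)
    assume "0 - 1 \<in> cspan weyl_ideal_generators"
    from complex_vector.span_neg[OF this] show False using one_notin_weyl_ideal by simp
  qed
qed (transfer; simp add: scaleC_add_left scaleC_add_right scaleC_scaleC scaleC_one
      complex_vector.span_zero mult_scaleC_left mult_scaleC_right algebra_simps)+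
end

lift_definition weyl_x :: weyl is "free_letter Letter_x" .

lift_definition weyl_d :: weyl is "free_letter Letter_d" .

lemma weyl_relation: "weyl_d * weyl_x - weyl_x * weyl_d = 1"
proof transfer
  show "free_letter Letter_d * free_letter Letter_x - free_letter Letter_x * free_letter Letter_d - 1
      \<in> cspan weyl_ideal_generators"
    by (rule complex_vector.span_base)
      (auto simp: weyl_ideal_generators_def weyl_relator_def intro!: exI[of _ 1])
qed


section \<open>The Lie algebra of derivations of the polynomial ring\<close>

typedef witt = "{w :: complex poly \<Rightarrow> complex poly.
    clinear w \<and> (\<forall>f g. w (f * g) = w f * g + f * w g)}"
  morphisms witt_apply Abs_witt
  by (rule exI[of _ "\<lambda>_. 0"]) (auto intro!: clinearI)

setup_lifting type_definition_witt

lemma derivationI: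
  assumes "\<And>f g. w (f + g) = w f + w g" "\<And>c f. w (smult c f) = smult c (w f)"
    "\<And>f g. w (f * g) = w f * g + f * w g"
  shows "clinear w \<and> (\<forall>f g. w (f * g) = w f * g + f * (w g :: complex poly))"
  using assms by (auto intro!: clinearI simp: scaleC_poly_eq_smult)

lemma derivationD:
  assumes "clinear w \<and> (\<forall>f g. w (f * g) = w f * g + f * (w g :: complex poly))"
  shows "w (f + g) = w f + w g" "w (f - g) = w f - w g" "w (smult c f) = smult c (w f)"
    "w (f * g) = w f * g + f * w g"
  using assms clinear_add[of w f g] clinear_diff[of w f g] clinear_scale[of w c f]
  by (auto simp: scaleC_poly_eq_smult)

lemmas witt_apply_derivation = derivationD[OF witt_apply[simplified mem_Collect_eq]]

instantiation witt :: lie_algebra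
begin
lift_definition zero_witt :: witt is "\<lambda>_. 0"
  by (rule derivationI) simp_all
lift_definition plus_witt :: "witt \<Rightarrow> witt \<Rightarrow> witt" is "\<lambda>v w f. v f + w f"
  subgoal for v w
    by (rule derivationI) (simp_all add: derivationD[of v] derivationD[of w] smult_add_right algebra_simps)
  done
lift_definition minus_witt :: "witt \<Rightarrow> witt \<Rightarrow> witt" is "\<lambda>v w f. v f - w f"
  subgoal for v w
    by (rule derivationI) (simp_all add: derivationD[of v] derivationD[of w] smult_diff_right algebra_simps)
  done
lift_definition uminus_witt :: "witt \<Rightarrow> witt" is "\<lambda>v f. - v f"
  subgoal for v
    by (rule derivationI) (simp_all add: derivationD[of v] algebra_simps)
  done
lift_definition scaleC_witt :: "complex \<Rightarrow> witt \<Rightarrow> witt" is "\<lambda>c v f. c *\<^sub>C v f"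
  subgoal for c v
    by (rule derivationI) (simp_all add: derivationD[of v] scaleC_poly_eq_smult smult_add_right mult.commute)
  done
lift_definition lie_bracket_witt :: "witt \<Rightarrow> witt \<Rightarrow> witt" is "\<lambda>v w f. v (w f) - w (v f)"
  subgoal for v w
    by (rule derivationI) (simp_all add: derivationD[of v] derivationD[of w] smult_diff_right algebra_simps)
  done
instance
proof
  fix x y z :: witt and c d :: complex
  show "x + y + z = x + (y + z)" "x + y = y + x" "0 + x = x" "- x + x = 0" "x - y = x + - y"
    by (transfer; simp add: fun_eq_iff algebra_simps)+
  show "c *\<^sub>C (x + y) = c *\<^sub>C x + c *\<^sub>C y" "(c + d) *\<^sub>C x = c *\<^sub>C x + d *\<^sub>C x"
    "c *\<^sub>C d *\<^sub>C x = (c * d) *\<^sub>C x" "1 *\<^sub>C x = x"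
    by (transfer; simp add: fun_eq_iff scaleC_add_left scaleC_add_right scaleC_scaleC scaleC_one)+
  show "lie_bracket (x + y) z = lie_bracket x z + lie_bracket y z"
    by (simp add: witt_apply_inject[symmetric] fun_eq_iff lie_bracket_witt.rep_eq
        plus_witt.rep_eq scaleC_witt.rep_eq zero_witt.rep_eq witt_apply_derivation
        scaleC_poly_eq_smult smult_diff_right)
  show "lie_bracket z (x + y) = lie_bracket z x + lie_bracket z y"
    by (simp add: witt_apply_inject[symmetric] fun_eq_iff lie_bracket_witt.rep_eq
        plus_witt.rep_eq scaleC_witt.rep_eq zero_witt.rep_eq witt_apply_derivation
        scaleC_poly_eq_smult smult_diff_right)
  show "lie_bracket (c *\<^sub>C x) y = c *\<^sub>C lie_bracket x y"
    by (simp add: witt_apply_inject[symmetric] fun_eq_iff lie_bracket_witt.rep_eq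
        plus_witt.rep_eq scaleC_witt.rep_eq zero_witt.rep_eq witt_apply_derivation
        scaleC_poly_eq_smult smult_diff_right)
  show "lie_bracket x (c *\<^sub>C y) = c *\<^sub>C lie_bracket x y"
    by (simp add: witt_apply_inject[symmetric] fun_eq_iff lie_bracket_witt.rep_eq
        plus_witt.rep_eq scaleC_witt.rep_eq zero_witt.rep_eq witt_apply_derivation
        scaleC_poly_eq_smult smult_diff_right)
  show "lie_bracket x x = 0"
    by (simp add: witt_apply_inject[symmetric] fun_eq_iff lie_bracket_witt.rep_eq
        plus_witt.rep_eq scaleC_witt.rep_eq zero_witt.rep_eq witt_apply_derivation
        scaleC_poly_eq_smult smult_diff_right)
  show "lie_bracket x (lie_bracket y z) + lie_bracket y (lie_bracket z x)
      + lie_bracket z (lie_bracket x y) = 0"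
    by (simp add: witt_apply_inject[symmetric] fun_eq_iff lie_bracket_witt.rep_eq
        plus_witt.rep_eq scaleC_witt.rep_eq zero_witt.rep_eq witt_apply_derivation
        scaleC_poly_eq_smult smult_diff_right)
qed
end

text \<open>\<open>d\<^sub>i = x\<^bsup>i+1\<^esup> \<partial>/\<partial>x\<close>; only meaningful for \<open>i \<ge> -1\<close>.\<close>

lift_definition witt_d :: "int \<Rightarrow> witt" is "\<lambda>i f. monom 1 (nat (i + 1)) * pderiv f"
  by (rule derivationI) (simp_all add: pderiv_add pderiv_smult pderiv_mult algebra_simps)

lemma witt_d_bracket:
  assumes "i \<ge> -1" "j \<ge> -1"
  shows "lie_bracket (witt_d i) (witt_d j) = of_int (j - i) *\<^sub>C witt_d (i + j)"
proof -
  define a b where "a = nat (i + 1)" and "b = nat (j + 1)"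
  have ij: "i = int a - 1" "j = int b - 1" using assms by (auto simp: a_def b_def)
  have key: "monom 1 a * pderiv (monom 1 b) - monom 1 b * pderiv (monom 1 a)
      = smult (of_nat b - of_nat a) (monom (1::complex) (a + b - 1))"
    by (cases a; cases b) (auto simp: pderiv_monom mult_monom smult_monom algebra_simps diff_monom minus_monom)
  have "monom 1 a * pderiv (monom 1 b * pderiv f) - monom 1 b * pderiv (monom 1 a * pderiv f)
      = (monom 1 a * pderiv (monom 1 b) - monom 1 b * pderiv (monom 1 a)) * pderiv f"
    for f :: "complex poly"
    by (simp add: pderiv_mult algebra_simps)
  moreover have "nat (i + j + 1) = a + b - 1" "(of_int (j - i) :: complex) = of_nat b - of_nat a"
    by (auto simp: ij)
  ultimately show ?thesis
    unfolding witt_apply_inject[symmetric] fun_eq_iff lie_bracket_witt.rep_eq scaleC_witt.rep_eq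
      witt_d.rep_eq
    by (simp add: key scaleC_poly_eq_smult a_def[symmetric] b_def[symmetric])
qed

definition witt_b :: "witt set" where
  "witt_b = cspan {witt_d i | i. i \<ge> 0}"

text \<open>
  A derivation \<open>w\<close> equals \<open>w(x) \<partial>/\<partial>x\<close>, so the coordinate of \<open>w\<close> at the basis element
  \<open>d\<^sub>i\<close> is the coefficient of \<open>x\<^bsup>i+1\<^esup>\<close> in the polynomial \<open>w(x)\<close>.
\<close>

definition witt_coord :: "witt \<Rightarrow> int \<Rightarrow> complex" where
  "witt_coord w i = coeff (witt_apply w [:0, 1:]) (nat (i + 1))"

lemma witt_coord_witt_d:
  assumes "i \<ge> -1" "m \<ge> -1"
  shows "witt_coord (witt_d m) i = (if i = m then 1 else 0)"
  using assms by (auto simp: witt_coord_def witt_d.rep_eq pderiv_pCons eq_nat_nat_iff)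

lemma finite_witt_coord: "finite {m. m \<ge> -1 \<and> witt_coord w m \<noteq> 0}"
proof (rule finite_subset)
  show "{m. m \<ge> -1 \<and> witt_coord w m \<noteq> 0} \<subseteq> {-1..int (degree (witt_apply w [:0, 1:]))}"
    using le_degree by (fastforce simp: witt_coord_def)
qed simp


section \<open>The modules \<open>T(P, V)\<close>\<close>

text \<open>
  \<open>T_basis \<alpha> \<rho> m\<close> is the operator by which the element \<open>\<phi>(d\<^sub>m)\<close> of \<open>D \<otimes> U(b)\<close> acts on \<open>P \<otimes> V\<close>,
  where \<open>\<alpha>\<close> and \<open>\<rho>\<close> are the actions on \<open>P\<close> and \<open>V\<close>. \<open>T_action\<close> extends it linearly from the
  basis of the \<open>d\<^sub>m\<close>, \<open>m \<ge> -1\<close>, to the whole Lie algebra.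
\<close>

definition T_basis ::
  "(weyl \<Rightarrow> 'p::complex_vector \<Rightarrow> 'p) \<Rightarrow> (witt \<Rightarrow> 'v::complex_vector \<Rightarrow> 'v)
     \<Rightarrow> int \<Rightarrow> ('p, 'v) tensor \<Rightarrow> ('p, 'v) tensor" where
  "T_basis \<alpha> \<rho> m t =
     (if m = -1 then tensor_map (\<alpha> weyl_d) id t
      else tensor_map (\<alpha> (weyl_x ^ nat (m + 1) * weyl_d)) id t
        + (\<Sum>r = 0..nat m. of_nat ((nat m + 1) choose (r + 1)) *\<^sub>C
             tensor_map (\<alpha> (weyl_x ^ (nat m - r))) (\<rho> (witt_d (int r))) t))"

definition T_action ::
  "(weyl \<Rightarrow> 'p::complex_vector \<Rightarrow> 'p) \<Rightarrow> (witt \<Rightarrow> 'v::complex_vector \<Rightarrow> 'v)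
     \<Rightarrow> witt \<Rightarrow> ('p, 'v) tensor \<Rightarrow> ('p, 'v) tensor" where
  "T_action \<alpha> \<rho> w t =
     (\<Sum>m | m \<ge> -1 \<and> witt_coord w m \<noteq> 0. witt_coord w m *\<^sub>C T_basis \<alpha> \<rho> m t)"

lemma T_action_witt_d:
  assumes "m \<ge> -1"
  shows "T_action \<alpha> \<rho> (witt_d m) = T_basis \<alpha> \<rho> m"
proof -
  have "{i. i \<ge> -1 \<and> witt_coord (witt_d m) i \<noteq> 0} = {m}"
    using assms by (auto simp: witt_coord_witt_d split: if_splits)
  then show ?thesis
    using assms by (simp add: fun_eq_iff T_action_def witt_coord_witt_d)
qed

end

theory Submission
  imports Defs
begin

text \<open>
  If \<open>f : P \<rightarrow> P'\<close> and \<open>g : V \<rightarrow> V'\<close> are isomorphisms, then \<open>f \<otimes> g\<close> is one between the Witt modules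
  (\<open>T_action_functor\<close>). The work is in the converse: from the Witt action alone one has to
  recover the operators \<open>x \<otimes> 1\<close> and \<open>1 \<otimes> d\<^sub>r\<close>.

  Put \<open>L = l + 1 \<ge> 2\<close>. On \<open>T(P, V)\<close> the element \<open>d\<^sub>m\<close> acts by a formula
  \<open>\<Sum>\<^sub>R (m + 1 choose R) X\<^bsup>m+1-R\<^esup> \<delta>\<^sub>R\<close> with \<open>R \<le> L\<close>, where \<open>\<delta>\<^sub>0 = \<partial> \<otimes> 1\<close> and
  \<open>\<delta>\<^bsub>r+1\<^esub> = 1 \<otimes> d\<^sub>r\<close>. If \<open>a + b\<close> is kept fixed, the coefficients of the product \<open>d\<^sub>a d\<^sub>b\<close> are
  polynomials in \<open>b\<close> of degree at most \<open>2 L\<close>, and only the coefficient of the operator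
  \<open>X\<^bsup>j\<^esup> \<delta>\<^sub>L\<^sup>2 = x\<^bsup>j\<^esup> \<otimes> d\<^sub>l\<^sup>2\<close> has degree exactly \<open>2 L\<close>. An alternating binomial sum of length \<open>2 L\<close>
  therefore isolates this operator (\<open>alternating_jet_sum\<close>), for every \<open>j \<ge> 0\<close>.

  An isomorphism \<open>\<psi>\<close> of Witt modules consequently intertwines \<open>x\<^bsup>j\<^esup> \<otimes> d\<^sub>l\<^sup>2\<close>. If the heights
  differed, one side would be zero and the other injective (\<open>T_action_height_le\<close>). If they agree,
  injectivity of \<open>d\<^sub>l\<close> allows to cancel \<open>d\<^sub>l\<^sup>2\<close>, so that \<open>\<psi>\<close> commutes with \<open>x \<otimes> 1\<close>, and then, by
  recursion on \<open>r\<close>, with every \<open>1 \<otimes> d\<^sub>r\<close> (\<open>jet_intertwiner\<close>). So \<open>\<psi>\<close> is an isomorphism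
  \<open>P \<otimes> V \<rightarrow> P' \<otimes> V'\<close> compatible with both actions separately. Composing it with
  \<open>p \<mapsto> p \<otimes> v\<^sub>0\<close> and \<open>id \<otimes> g\<close>, for a vector \<open>v\<^sub>0\<close> and a functional \<open>g\<close>, gives a nonzero
  homomorphism between the simple modules \<open>P\<close> and \<open>P'\<close>, which must be bijective, and in the same way
  one between \<open>V\<close> and \<open>V'\<close> (\<open>T_action_iso_factors\<close>).
\<close>

section \<open>Alternating binomial sums\<close>

text \<open>
  Summation by parts: passing from an alternating sum of length \<open>n + 1\<close> to one of length \<open>n\<close>
  replaces the sequence by its differences. This is what drives the induction below.
\<close>

lemma alternating_sum_Suc:
  fixes a :: "nat \<Rightarrow> 'a::comm_ring_1"
  shows "(\<Sum>i\<le>Suc n. (-1) ^ i * of_nat (Suc n choose i) * a i)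
    = (\<Sum>i\<le>n. (-1) ^ i * of_nat (n choose i) * (a i - a (Suc i)))"
proof -
  have z: "(\<Sum>i\<le>n. (-1) ^ i * of_nat (n choose i) * a i) =
     a 0 + (\<Sum>i\<le>n. (-1) ^ Suc i * of_nat (n choose Suc i) * a (Suc i))"
  proof -
    have "(\<Sum>i\<le>n. (-1) ^ i * of_nat (n choose i) * a i)
       = (\<Sum>i\<le>Suc n. (-1) ^ i * of_nat (n choose i) * a i)"
      by (simp add: binomial_eq_0)
    also have "\<dots> = a 0 + (\<Sum>i\<le>n. (-1) ^ Suc i * of_nat (n choose Suc i) * a (Suc i))"
      by (subst sum.atMost_Suc_shift) simp
    finally show ?thesis .
  qed
  have "(\<Sum>i\<le>Suc n. (-1) ^ i * of_nat (Suc n choose i) * a i)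
     = a 0 + (\<Sum>i\<le>n. (-1) ^ Suc i * of_nat (n choose Suc i) * a (Suc i))
       - (\<Sum>i\<le>n. (-1) ^ i * of_nat (n choose i) * a (Suc i))"
    by (subst sum.atMost_Suc_shift)
      (simp add: algebra_simps sum.distrib sum_subtractf sum_negf)
  then show ?thesis
    unfolding z[symmetric] by (simp add: sum_subtractf right_diff_distrib)
qed

text \<open>
  As a function of \<open>i\<close>, the product \<open>(K - i choose R) (i choose S)\<close> is a polynomial of degree
  \<open>R + S\<close>, and the sum is (up to sign) its \<open>N\<close>-th difference. So it vanishes below degree \<open>N\<close>,
  and in degree \<open>N\<close> it sees only the leading coefficient. The induction on
  \<open>N\<close> works because, by Pascal's rule, the difference of such a product is a difference of two products
  of the same shape, with \<open>R\<close> or \<open>S\<close> lowered by one.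
\<close>

lemma alternating_binomial_product_sum:
  fixes N K R S :: nat
  assumes "N \<le> K" "R + S \<le> N"
  shows "(\<Sum>i\<le>N. (-1) ^ i * of_nat (N choose i) * of_nat ((K - i choose R) * (i choose S)))
    = (if R + S = N then (-1) ^ S * of_nat (N choose S) else (0::'a::comm_ring_1))"
  using assms
proof (induction N arbitrary: K R S)
  case 0
  then show ?case by simp
next
  case (Suc N)
  then obtain K' where K: "K = Suc K'" "N \<le> K'" by (cases K) auto
  define B :: "nat \<Rightarrow> nat \<Rightarrow> 'a" where "B R S = (\<Sum>i\<le>N. (-1) ^ i * of_nat (N choose i) * of_nat ((K' - i choose R) * (i choose S)))"
    for R S
  have B: "B R S = (if R + S = N then (-1) ^ S * of_nat (N choose S) else 0)" if "R + S \<le> N" for R S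
    unfolding B_def using Suc.IH[OF K(2) that] .
  have "(\<Sum>i\<le>Suc N. (-1) ^ i * of_nat (Suc N choose i) * of_nat ((K - i choose R) * (i choose S)))
      = (\<Sum>i\<le>N. (-1) ^ i * of_nat (N choose i) *
          ((if R = 0 then 0 else of_nat ((K' - i choose (R - 1)) * (i choose S)))
          - (if S = 0 then 0 else of_nat ((K' - i choose R) * (i choose (S - 1)))) :: 'a))"
    unfolding alternating_sum_Suc
  proof (intro sum.cong refl arg_cong2[where f = "(*)"])
    fix i assume "i \<in> {..N}"
    then have *: "K - i = Suc (K' - i)" using K by auto
    show "of_nat ((K - i choose R) * (i choose S)) - of_nat ((K - Suc i choose R) * (Suc i choose S))
      = (if R = 0 then 0 else of_nat ((K' - i choose (R - 1)) * (i choose S)))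
          - (if S = 0 then 0 else of_nat ((K' - i choose R) * (i choose (S - 1))) :: 'a)"
      unfolding * using K(1) by (cases R; cases S) (simp_all add: algebra_simps)
  qed
  also have "\<dots> = (if R = 0 then 0 else B (R - 1) S) - (if S = 0 then 0 else B R (S - 1))"
    by (cases "R = 0"; cases "S = 0") (simp_all add: B_def right_diff_distrib sum_subtractf sum_negf)
  also have "\<dots> = (if R + S = Suc N then (-1) ^ S * of_nat (Suc N choose S) else 0)"
    using Suc.prems B[of "R - 1" S] B[of R "S - 1"] by (cases R; cases S) (auto simp: algebra_simps)
  finally show ?case .
qed

section \<open>Extracting the top operator from a family of jets\<close>

text \<open>
  The operator \<open>X\<close> is multiplication by \<open>x\<close>, and \<open>\<delta> R\<close> stands for \<open>1 \<otimes> d\<^bsub>R-1\<^esub>\<close>, where the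
  index \<open>R = 0\<close> means the derivative \<open>\<partial> \<otimes> 1\<close>. Shifting the index by one gives all basis elements
  of the Witt algebra the same formula \<open>jet M\<close>, with \<open>M = m + 1\<close>.
\<close>

locale jet_operators =
  fixes X :: "'t::complex_vector \<Rightarrow> 't" and \<delta> :: "nat \<Rightarrow> 't \<Rightarrow> 't"
  assumes clinear_X: "clinear X"
    and clinear_\<delta>: "clinear (\<delta> R)"
    and \<delta>_X: "\<delta> R (X t) = X (\<delta> R t) + (if R = 0 then t else 0)"
begin

definition jet :: "nat \<Rightarrow> 't \<Rightarrow> 't" where
  "jet M t = (\<Sum>R\<le>M. of_nat (M choose R) *\<^sub>C (X ^^ (M - R)) (\<delta> R t))"

lemma clinear_X_pow: "clinear (X ^^ n)"
  by (induction n) (auto intro!: clinearI simp: clinear_add[OF clinear_X] clinear_scale[OF clinear_X]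
      clinear_add clinear_scale)

lemma \<delta>_X_pow:
  "\<delta> R ((X ^^ n) t) = (X ^^ n) (\<delta> R t) + (if R = 0 then of_nat n *\<^sub>C (X ^^ (n - 1)) t else 0)"
proof (induction n)
  case (Suc n)
  have "X ((X ^^ (n - 1)) t) = (X ^^ n) t" if "n > 0"
    using that by (cases n) auto
  then show ?case
    by (cases "n = 0") (auto simp: \<delta>_X Suc clinear_add[OF clinear_X] clinear_scale[OF clinear_X]
        scaleC_add_left scaleC_one clinear_zero[OF clinear_X])
qed simp

lemma jet_bounded:
  assumes "\<forall>R>L. \<forall>t. \<delta> R t = 0"
  shows "jet M t = (\<Sum>R\<le>L. of_nat (M choose R) *\<^sub>C (X ^^ (M - R)) (\<delta> R t))"
proof -
  have "jet M t = (\<Sum>R\<le>max M L. of_nat (M choose R) *\<^sub>C (X ^^ (M - R)) (\<delta> R t))"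
    unfolding jet_def by (rule sum.mono_neutral_left) auto
  also have "\<dots> = (\<Sum>R\<le>L. of_nat (M choose R) *\<^sub>C (X ^^ (M - R)) (\<delta> R t))"
    by (rule sum.mono_neutral_right) (auto simp: assms clinear_zero[OF clinear_X_pow])
  finally show ?thesis .
qed

text \<open>
  Since only \<open>\<delta> 0\<close> fails to commute with \<open>X\<close>, moving all powers of \<open>X\<close> to the left produces a
  correction, the second sum, only from the terms with \<open>R = 0\<close>. Its coefficient
  \<open>(N choose S) (N - S)\<close> is written as \<open>(S + 1) (N choose (S + 1))\<close> to exhibit it as a
  polynomial in \<open>N\<close> of degree \<open>S + 1\<close>.
\<close>

lemma jet_jet:
  assumes bounded: "\<forall>R>L. \<forall>t. \<delta> R t = 0"
  shows "jet M (jet N t) =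
    (\<Sum>R\<le>L. \<Sum>S\<le>L. of_nat ((M choose R) * (N choose S)) *\<^sub>C (X ^^ (M + N - R - S)) (\<delta> R (\<delta> S t)))
    + (\<Sum>S\<le>L. (of_nat (Suc S) * of_nat (N choose Suc S)) *\<^sub>C (X ^^ (M + N - Suc S)) (\<delta> S t))"
proof -
  have pow: "(X ^^ a) ((X ^^ b) u) = (X ^^ (a + b)) u" for a b u
    by (simp add: funpow_add)
  have lin: "clinear (\<lambda>u. of_nat (M choose R) *\<^sub>C (X ^^ (M - R)) (\<delta> R u))" for R
    by (rule clinearI) (simp_all add: clinear_add[OF clinear_X_pow] clinear_scale[OF clinear_X_pow]
      clinear_add[OF clinear_\<delta>] clinear_scale[OF clinear_\<delta>] scaleC_add_right scaleC_scaleC mult.commute)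
  have main: "of_nat (M choose R) *\<^sub>C (X ^^ (M - R)) (\<delta> R (of_nat (N choose S) *\<^sub>C (X ^^ (N - S)) (\<delta> S t)))
     = of_nat ((M choose R) * (N choose S)) *\<^sub>C (X ^^ (M + N - R - S)) (\<delta> R (\<delta> S t))
       + (if R = 0 then (of_nat (Suc S) * of_nat (N choose Suc S)) *\<^sub>C (X ^^ (M + N - Suc S)) (\<delta> S t) else 0)"
    for R S
  proof (cases "R \<le> M \<and> S \<le> N")
    case False
    then show ?thesis
      by (auto simp: clinear_scale[OF clinear_\<delta>] clinear_zero[OF clinear_X_pow] binomial_eq_0)
  next
    case True
    \<comment> \<open>If \<open>R > M\<close> or \<open>S > N\<close>, the truncated exponents do not add up, but then the binomial coefficients vanish.\<close>
    have "M - R + (N - S) = M + N - R - S" using True by simp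
    \<comment> \<open>For \<open>N = S\<close> the truncated exponents differ, but the correction term has coefficient \<open>0\<close>.\<close>
    moreover have "M + (N - S - 1) = M + N - Suc S \<or> N = S" using True by auto
    moreover have "(N choose S) * (N - S) = Suc S * (N choose Suc S)"
      using binomial_absorb_comp[of N S] binomial_absorption[of S N] by (metis mult.commute)
    then have "of_nat (N choose S) * of_nat (N - S) = (of_nat (Suc S) * of_nat (N choose Suc S) :: complex)"
      by (metis of_nat_mult)
    ultimately show ?thesis
      by (auto simp: clinear_scale[OF clinear_\<delta>] clinear_scale[OF clinear_X_pow] \<delta>_X_pow clinear_zero[OF clinear_X_pow]
          clinear_add[OF clinear_X_pow] pow scaleC_add_right scaleC_scaleC)
  qed
  have "jet M (jet N t) = (\<Sum>R\<le>L. \<Sum>S\<le>L. of_nat (M choose R) *\<^sub>C (X ^^ (M - R))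
      (\<delta> R (of_nat (N choose S) *\<^sub>C (X ^^ (N - S)) (\<delta> S t))))"
    unfolding jet_bounded[OF bounded]
    by (simp add: complex_vector.linear_sum[OF lin])
  also have "\<dots> = (\<Sum>R\<le>L. \<Sum>S\<le>L. of_nat ((M choose R) * (N choose S)) *\<^sub>C (X ^^ (M + N - R - S)) (\<delta> R (\<delta> S t)))
     + (\<Sum>R\<le>L. if R = 0 then (\<Sum>S\<le>L. (of_nat (Suc S) * of_nat (N choose Suc S)) *\<^sub>C (X ^^ (M + N - Suc S)) (\<delta> S t)) else 0)"
    unfolding main sum.distrib by (intro arg_cong2[where f = "(+)"] sum.cong refl) auto
  finally show ?thesis
    by simp
qed

text \<open>
  With \<open>M + N = 2 L + j\<close> fixed, the coefficients of \<open>jet M (jet N t)\<close> are polynomials in \<open>N\<close>.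
  Their degrees are \<open>R + S \<le> 2 L\<close> in the main part, with equality only for \<open>R = S = L\<close>, and
  \<open>S + 1 \<le> L + 1\<close> in the correction, which is below \<open>2 L\<close> because \<open>L \<ge> 2\<close>. Hence the
  \<open>2 L\<close>-th difference kills everything except \<open>X\<^bsup>j\<^esup> \<delta>\<^sub>L\<^sup>2\<close>.
\<close>

lemma alternating_jet_sum:
  assumes bounded: "\<forall>R>L. \<forall>t. \<delta> R t = 0" and L: "2 \<le> L"
  shows "(\<Sum>i\<le>2 * L. ((-1) ^ i * of_nat (2 * L choose i)) *\<^sub>C jet (2 * L + j - i) (jet i t))
    = ((-1) ^ L * of_nat (2 * L choose L)) *\<^sub>C (X ^^ j) (\<delta> L (\<delta> L t))"
proof -
  define c :: "nat \<Rightarrow> complex" where "c i = (-1) ^ i * of_nat (2 * L choose i)" for i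
  define A where "A R S = (X ^^ (2 * L + j - R - S)) (\<delta> R (\<delta> S t))" for R S
  define B where "B S = (X ^^ (2 * L + j - Suc S)) (\<delta> S t)" for S
  have first: "(\<Sum>i\<le>2 * L. c i * of_nat ((2 * L + j - i choose R) * (i choose S)))
      = (if R + S = 2 * L then c S else 0)" if "R \<le> L" "S \<le> L" for R S
    unfolding c_def by (rule alternating_binomial_product_sum) (use that in auto)
  have second: "(\<Sum>i\<le>2 * L. c i * (of_nat (Suc S) * of_nat (i choose Suc S))) = 0" if "S \<le> L" for S
  proof -
    have "(\<Sum>i\<le>2 * L. c i * of_nat ((2 * L - i choose 0) * (i choose Suc S))) = 0"
      unfolding c_def by (subst alternating_binomial_product_sum) (use that L in auto)
    then have "of_nat (Suc S) * (\<Sum>i\<le>2 * L. c i * of_nat (i choose Suc S)) = 0"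
      by simp
    then show ?thesis
      by (simp only: sum_distrib_left mult.left_commute)
  qed
  have "(\<Sum>i\<le>2 * L. c i *\<^sub>C jet (2 * L + j - i) (jet i t))
     = (\<Sum>i\<le>2 * L. (\<Sum>R\<le>L. \<Sum>S\<le>L. (c i * of_nat ((2 * L + j - i choose R) * (i choose S))) *\<^sub>C A R S)
       + (\<Sum>S\<le>L. (c i * (of_nat (Suc S) * of_nat (i choose Suc S))) *\<^sub>C B S))"
  proof (rule sum.cong[OF refl])
    fix i assume "i \<in> {..2 * L}"
    then have "2 * L + j - i + i = 2 * L + j" by simp
    then show "c i *\<^sub>C jet (2 * L + j - i) (jet i t)
      = (\<Sum>R\<le>L. \<Sum>S\<le>L. (c i * of_nat ((2 * L + j - i choose R) * (i choose S))) *\<^sub>C A R S)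
       + (\<Sum>S\<le>L. (c i * (of_nat (Suc S) * of_nat (i choose Suc S))) *\<^sub>C B S)"
      unfolding jet_jet[OF bounded] A_def B_def
      by (simp only: scaleC_add_right complex_vector.scale_sum_right scaleC_scaleC)
  qed
  also have "\<dots> = (\<Sum>R\<le>L. \<Sum>S\<le>L. (\<Sum>i\<le>2 * L. c i * of_nat ((2 * L + j - i choose R) * (i choose S))) *\<^sub>C A R S)
       + (\<Sum>S\<le>L. (\<Sum>i\<le>2 * L. c i * (of_nat (Suc S) * of_nat (i choose Suc S))) *\<^sub>C B S)"
    unfolding sum.distrib complex_vector.scale_sum_left
    by (subst sum.swap, subst (2) sum.swap, subst (3) sum.swap) (rule refl)
  also have "\<dots> = (\<Sum>R\<le>L. \<Sum>S\<le>L. if R = L \<and> S = L then c L *\<^sub>C A L L else 0)"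
  proof -
    have "(\<Sum>R\<le>L. \<Sum>S\<le>L. (\<Sum>i\<le>2 * L. c i * of_nat ((2 * L + j - i choose R) * (i choose S))) *\<^sub>C A R S)
        = (\<Sum>R\<le>L. \<Sum>S\<le>L. if R = L \<and> S = L then c L *\<^sub>C A L L else 0)"
    proof (intro sum.cong refl)
      fix R S assume "R \<in> {..L}" "S \<in> {..L}"
      then show "(\<Sum>i\<le>2 * L. c i * of_nat ((2 * L + j - i choose R) * (i choose S))) *\<^sub>C A R S
        = (if R = L \<and> S = L then c L *\<^sub>C A L L else 0)"
        using first[of R S] by auto
    qed
    moreover have "(\<Sum>S\<le>L. (\<Sum>i\<le>2 * L. c i * (of_nat (Suc S) * of_nat (i choose Suc S))) *\<^sub>C B S) = 0"
      using second by (intro sum.neutral ballI) (simp only: atMost_iff complex_vector.scale_zero_left)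
    ultimately show ?thesis by (simp only: add_0_right)
  qed
  also have "\<dots> = (\<Sum>R\<le>L. if R = L then c L *\<^sub>C A L L else 0)"
    by (intro sum.cong refl) auto
  also have "\<dots> = c L *\<^sub>C A L L" by simp
  finally show ?thesis by (simp add: c_def A_def)
qed

end

text \<open>
  The operator \<open>X\<^bsup>j\<^esup> \<delta>\<^sub>L\<^sup>2\<close> is, up to a nonzero scalar, a universal quadratic expression in the jets,
  so every map that intertwines the jets intertwines it. The number \<open>L\<close> is only an
  upper bound for the two heights, so that families of different heights can be compared: on the
  lower one \<open>\<delta>\<^sub>L\<close> is zero.
\<close>

lemma jet_intertwiner_top:
  assumes "jet_operators X \<delta>" "jet_operators X' \<delta>'" and psi: "clinear \<psi>"
    and jet: "\<And>M t. \<psi> (jet_operators.jet X \<delta> M t) = jet_operators.jet X' \<delta>' M (\<psi> t)"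
    and "\<forall>R>L. \<forall>t. \<delta> R t = 0" "\<forall>R>L. \<forall>t. \<delta>' R t = 0" "2 \<le> L"
  shows "\<psi> ((X ^^ j) (\<delta> L (\<delta> L t))) = (X' ^^ j) (\<delta>' L (\<delta>' L (\<psi> t)))"
proof -
  interpret A: jet_operators X \<delta> by fact
  interpret B: jet_operators X' \<delta>' by fact
  let ?c = "(-1) ^ L * of_nat (2 * L choose L) :: complex"
  have "?c *\<^sub>C \<psi> ((X ^^ j) (\<delta> L (\<delta> L t))) = ?c *\<^sub>C (X' ^^ j) (\<delta>' L (\<delta>' L (\<psi> t)))"
    using A.alternating_jet_sum[of L j t] B.alternating_jet_sum[of L j "\<psi> t"] assms(5-)
    by (simp add: clinear_scale[OF psi, symmetric] jet[symmetric] complex_vector.linear_sum[OF psi, symmetric])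
  moreover have "?c \<noteq> 0" by simp
  ultimately show ?thesis
    using complex_vector.scale_cancel_left by blast
qed

text \<open>
  Comparing the cases \<open>j = 0\<close> and \<open>j = 1\<close> shows \<open>\<delta>'\<^sub>L\<^sup>2 (\<psi> X - X' \<psi>) = 0\<close>, and injectivity of
  \<open>\<delta>'\<^sub>L\<close> cancels the square. Once \<open>\<psi>\<close> commutes with \<open>X\<close>, the individual \<open>\<delta> R\<close> can be solved
  for recursively, since \<open>jet R\<close> is \<open>\<delta> R\<close> plus terms with smaller indices.
\<close>

lemma jet_intertwiner:
  assumes jo: "jet_operators X \<delta>" "jet_operators X' \<delta>'" and psi: "clinear \<psi>"
    and jet: "\<And>M t. \<psi> (jet_operators.jet X \<delta> M t) = jet_operators.jet X' \<delta>' M (\<psi> t)"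
    and bd: "\<forall>R>L. \<forall>t. \<delta> R t = 0" "\<forall>R>L. \<forall>t. \<delta>' R t = 0" "2 \<le> L"
    and inj: "inj (\<delta>' L)"
  shows "\<psi> (X t) = X' (\<psi> t)" and "\<psi> (\<delta> R t) = \<delta>' R (\<psi> t)"
proof -
  interpret A: jet_operators X \<delta> by fact
  interpret B: jet_operators X' \<delta>' by fact
  note top = jet_intertwiner_top[OF jo psi jet bd]
  have X: "\<psi> (X t) = X' (\<psi> t)" for t
  proof -
    have L: "L \<noteq> 0" using bd(3) by simp
    have "\<delta>' L (\<delta>' L (\<psi> (X t))) = \<psi> (\<delta> L (\<delta> L (X t)))"
      using top[of 0 "X t"] by simp
    also have "\<dots> = \<psi> (X (\<delta> L (\<delta> L t)))" using L by (simp add: A.\<delta>_X)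
    also have "\<dots> = X' (\<delta>' L (\<delta>' L (\<psi> t)))" using top[of 1 t] by simp
    also have "\<dots> = \<delta>' L (\<delta>' L (X' (\<psi> t)))" using L by (simp add: B.\<delta>_X)
    finally show ?thesis using inj by (simp add: inj_eq)
  qed
  then have Xp: "\<psi> ((X ^^ n) t) = (X' ^^ n) (\<psi> t)" for n t
    by (induction n) auto
  show "\<psi> (X t) = X' (\<psi> t)" by (rule X)
  show "\<psi> (\<delta> R t) = \<delta>' R (\<psi> t)"
  proof (induction R rule: less_induct)
    case (less R)
    have "\<psi> (A.jet R t) = B.jet R (\<psi> t)" by (rule jet)
    then show ?case using less
      by (simp add: A.jet_def B.jet_def lessThan_Suc_atMost[symmetric] clinear_add[OF psi]
          complex_vector.linear_sum[OF psi] clinear_scale[OF psi] Xp scaleC_one)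
  qed
qed

section \<open>Detecting tensors by linear functionals\<close>

lemma coordinate_functionals:
  obtains r :: "'a::complex_vector \<Rightarrow> 'a \<Rightarrow> complex"
  where "\<And>b. clinear (r b)" "\<And>v. finite {b. r b v \<noteq> 0}" "\<And>v. (\<Sum>b | r b v \<noteq> 0. r b v *\<^sub>C b) = v"
proof -
  define B :: "'a set" where "B = complex_vector.extend_basis {}"
  have B: "complex_vector.independent B" "cspan B = UNIV"
    unfolding B_def
    by (simp_all add: complex_vector.independent_empty complex_vector.independent_extend_basis)
  show ?thesis
  proof (rule that[of "\<lambda>b v. complex_vector.representation B v b"])
    show "clinear (\<lambda>v. complex_vector.representation B v b)" for b
      by (rule clinearI) (simp_all add: complex_vector.representation_add complex_vector.representation_scale B)
  qed (simp_all add: complex_vector.finite_representation complex_vector.sum_nonzero_representation_eq B)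
qed

lemma functional_nonzero:
  fixes p :: "'a::complex_vector"
  assumes "p \<noteq> 0"
  obtains f :: "'a \<Rightarrow> complex" where "clinear f" "f p \<noteq> 0"
proof -
  obtain r :: "'a \<Rightarrow> 'a \<Rightarrow> complex" where r: "\<And>b. clinear (r b)" "\<And>v. (\<Sum>b | r b v \<noteq> 0. r b v *\<^sub>C b) = v"
    using coordinate_functionals by metis
  have "\<exists>b. r b p \<noteq> 0"
    using r(2)[of p] assms by (metis (mono_tags, lifting) empty_Collect_eq sum.empty)
  then show ?thesis using that r(1) by blast
qed

lemma tensor_of_zero:
  fixes a :: "'a::complex_vector" and b :: "'b::complex_vector"
  shows "(0::'a) \<otimes>\<^sub>t b = 0" "a \<otimes>\<^sub>t (0::'b) = 0"
proof -
  show "(0::'a) \<otimes>\<^sub>t b = 0"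
    using tensor_of_scale_left[of 0 "0::'a" b] by simp
  show "a \<otimes>\<^sub>t (0::'b) = 0"
    using tensor_of_scale_right[of a 0 "0::'b"] by simp
qed

definition tensor_lift ::
  "('a::complex_vector \<Rightarrow> 'b::complex_vector \<Rightarrow> 'c::complex_vector) \<Rightarrow> ('a, 'b) tensor \<Rightarrow> 'c" where
  "tensor_lift f = (THE h. clinear h \<and> (\<forall>a b. h (a \<otimes>\<^sub>t b) = f a b))"

lemma
  assumes "bilinear_map f"
  shows clinear_tensor_lift: "clinear (tensor_lift f)"
    and tensor_lift_tensor_of [simp]: "tensor_lift f (a \<otimes>\<^sub>t b) = f a b"
  using theI'[OF tensor_universal[OF assms], folded tensor_lift_def] by auto

text \<open>
  For linear functionals \<open>f\<close> and \<open>g\<close>, \<open>slice_left g\<close> is \<open>id \<otimes> g\<close> and \<open>slice_right f\<close> is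
  \<open>f \<otimes> id\<close>, after identifying a tensor product with the field \<open>\<complex>\<close> with the other factor.
\<close>

abbreviation slice_left :: "('b \<Rightarrow> complex) \<Rightarrow> ('a::complex_vector, 'b::complex_vector) tensor \<Rightarrow> 'a" where
  "slice_left g \<equiv> tensor_lift (\<lambda>a b. g b *\<^sub>C a)"

abbreviation slice_right :: "('a \<Rightarrow> complex) \<Rightarrow> ('a::complex_vector, 'b::complex_vector) tensor \<Rightarrow> 'b" where
  "slice_right f \<equiv> tensor_lift (\<lambda>a b. f a *\<^sub>C b)"

lemma bilinear_slices:
  assumes "clinear g"
  shows "bilinear_map (\<lambda>a b. g b *\<^sub>C a)" "bilinear_map (\<lambda>a b. g a *\<^sub>C b)"
  unfolding bilinear_map_def
  by (auto intro!: clinearI simp: clinear_add[OF assms] clinear_scale[OF assms] scaleC_add_left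
      scaleC_add_right scaleC_scaleC mult.commute)

lemma tensor_linear_eqI:
  assumes "clinear h" "clinear k" "\<And>a b. h (a \<otimes>\<^sub>t b) = k (a \<otimes>\<^sub>t b)"
  shows "h t = k t"
  by (induction t rule: tensor_induct) (use assms in \<open>auto simp: clinear_add\<close>)

lemma clinear_compose: "clinear f \<Longrightarrow> clinear g \<Longrightarrow> clinear (\<lambda>x. g (f x))"
  by (rule clinearI) (simp_all add: clinear_add clinear_scale)

lemmas clinear_slices = bilinear_slices[THEN clinear_tensor_lift]

text \<open>
  Both sides are \<open>f \<otimes> g\<close>, so one nonvanishing value serves the slices in both directions.
\<close>

lemma slice_commute:
  assumes "clinear f" "clinear g"
  shows "f (slice_left g t) = g (slice_right f t)"
  by (rule tensor_linear_eqI)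
    (use assms in \<open>simp_all add: clinear_compose clinear_slices bilinear_slices clinear_scale\<close>)

text \<open>
  In coordinates with respect to a basis of the second factor, a tensor is recovered from its
  slices as \<open>\<Sum>\<^sub>b (id \<otimes> b\<^sup>*)(t) \<otimes> b\<close>. If it is nonzero, so is one of the slices, and a functional on
  the first factor detects that slice.
\<close>

lemma tensor_functionals_nonzero:
  fixes t :: "('a::complex_vector, 'b::complex_vector) tensor"
  assumes "t \<noteq> 0"
  obtains f :: "'a \<Rightarrow> complex" and g where "clinear f" "clinear g" "f (slice_left g t) \<noteq> 0"
proof -
  obtain r :: "'b \<Rightarrow> 'b \<Rightarrow> complex" where lin: "\<And>b. clinear (r b)"
    and fin: "\<And>v. finite {b. r b v \<noteq> 0}" and repr: "\<And>v. (\<Sum>b | r b v \<noteq> 0. r b v *\<^sub>C b) = v"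
    using coordinate_functionals[where 'a = 'b] by blast
  note sl = clinear_slices(1)[OF lin]
  have "\<exists>F. finite F \<and> (\<forall>b. b \<notin> F \<longrightarrow> slice_left (r b) u = 0) \<and> u = (\<Sum>b\<in>F. slice_left (r b) u \<otimes>\<^sub>t b)"
    for u :: "('a, 'b) tensor"
  proof (induction u rule: tensor_induct)
    case (tensor_of a v)
    let ?F = "{b. r b v \<noteq> 0}"
    have lin_a: "clinear (\<lambda>b. a \<otimes>\<^sub>t b)"
      using bilinear_tensor_of unfolding bilinear_map_def by blast
    have "a \<otimes>\<^sub>t v = a \<otimes>\<^sub>t (\<Sum>b\<in>?F. r b v *\<^sub>C b)"
      by (simp only: repr)
    also have "\<dots> = (\<Sum>b\<in>?F. (r b v *\<^sub>C a) \<otimes>\<^sub>t b)"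
      by (simp add: complex_vector.linear_sum[OF lin_a] tensor_of_scale_left tensor_of_scale_right)
    finally have sum: "a \<otimes>\<^sub>t v = (\<Sum>b\<in>?F. (r b v *\<^sub>C a) \<otimes>\<^sub>t b)" .
    have slice: "slice_left (r b) (a \<otimes>\<^sub>t v) = r b v *\<^sub>C a" for b
      by (simp add: bilinear_slices lin)
    show ?case
    proof (intro exI[of _ ?F] conjI allI impI)
      show "finite ?F" by (rule fin)
      show "slice_left (r b) (a \<otimes>\<^sub>t v) = 0" if "b \<notin> ?F" for b
        using that by (simp add: slice)
      show "a \<otimes>\<^sub>t v = (\<Sum>b\<in>?F. slice_left (r b) (a \<otimes>\<^sub>t v) \<otimes>\<^sub>t b)"
        unfolding slice by (rule sum)
    qed
  next
    case (add s u)
    then obtain F G where F: "finite F" "\<And>b. b \<notin> F \<Longrightarrow> slice_left (r b) s = 0" "s = (\<Sum>b\<in>F. slice_left (r b) s \<otimes>\<^sub>t b)"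
      and G: "finite G" "\<And>b. b \<notin> G \<Longrightarrow> slice_left (r b) u = 0" "u = (\<Sum>b\<in>G. slice_left (r b) u \<otimes>\<^sub>t b)"
      by blast
    have extend: "(\<Sum>b\<in>F. slice_left (r b) s \<otimes>\<^sub>t b) = (\<Sum>b\<in>F \<union> G. slice_left (r b) s \<otimes>\<^sub>t b)"
      "(\<Sum>b\<in>G. slice_left (r b) u \<otimes>\<^sub>t b) = (\<Sum>b\<in>F \<union> G. slice_left (r b) u \<otimes>\<^sub>t b)"
      by (rule sum.mono_neutral_left; simp add: F(1,2) G(1,2) tensor_of_zero)+
    have sum: "s + u = (\<Sum>b\<in>F \<union> G. (slice_left (r b) s + slice_left (r b) u) \<otimes>\<^sub>t b)"
      unfolding tensor_of_add_left sum.distrib extend[symmetric]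
      by (rule arg_cong2[where f = "(+)", OF F(3) G(3)])
    show ?case
    proof (intro exI[of _ "F \<union> G"] conjI allI impI)
      show "finite (F \<union> G)" using F(1) G(1) by simp
      show "slice_left (r b) (s + u) = 0" if "b \<notin> F \<union> G" for b
        using that F(2) G(2) by (simp add: clinear_add[OF sl])
      show "s + u = (\<Sum>b\<in>F \<union> G. slice_left (r b) (s + u) \<otimes>\<^sub>t b)"
        unfolding clinear_add[OF sl] by (rule sum)
    qed
  qed
  then obtain F where F: "t = (\<Sum>b\<in>F. slice_left (r b) t \<otimes>\<^sub>t b)"
    by blast
  have "\<exists>b. slice_left (r b) t \<noteq> 0"
  proof (rule ccontr)
    assume "\<nexists>b. slice_left (r b) t \<noteq> 0"
    then have "t = (\<Sum>b\<in>F. 0 \<otimes>\<^sub>t b)" using F by simp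
    also have "\<dots> = 0"
      by (simp add: tensor_of_zero)
    finally show False using assms by simp
  qed
  then obtain b where "slice_left (r b) t \<noteq> 0" by blast
  then obtain f :: "'a \<Rightarrow> complex" where "clinear f" "f (slice_left (r b) t) \<noteq> 0"
    using functional_nonzero by blast
  then show ?thesis using that lin by blast
qed

lemma tensor_of_nonzero:
  fixes a :: "'a::complex_vector" and b :: "'b::complex_vector"
  assumes "a \<noteq> 0" "b \<noteq> 0"
  shows "a \<otimes>\<^sub>t b \<noteq> 0"
proof
  assume "a \<otimes>\<^sub>t b = 0"
  obtain g :: "'b \<Rightarrow> complex" where g: "clinear g" "g b \<noteq> 0"
    using functional_nonzero[OF assms(2)] .
  have "slice_left g (a \<otimes>\<^sub>t b) = g b *\<^sub>C a"
    by (simp add: bilinear_slices g)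
  moreover have "slice_left g (0 :: ('a, 'b) tensor) = 0"
    by (rule clinear_zero[OF clinear_slices(1)[OF g(1)]])
  ultimately have "g b *\<^sub>C a = 0"
    using \<open>a \<otimes>\<^sub>t b = 0\<close> by simp
  then show False
    using g assms by simp
qed

text \<open>
  The operator \<open>id \<otimes> A\<close> acts on each slice \<open>(f \<otimes> id)(t)\<close> as \<open>A\<close>, and a tensor all of whose slices
  vanish is zero.
\<close>

lemma inj_tensor_map_id_left:
  fixes A :: "'b::complex_vector \<Rightarrow> 'c::complex_vector"
  assumes A: "clinear A" "inj A"
  shows "inj (tensor_map (id :: 'a::complex_vector \<Rightarrow> 'a) A)"
proof -
  have id: "clinear (id :: 'a \<Rightarrow> 'a)" by (rule clinearI) simp_all
  define M where "M = tensor_map (id :: 'a \<Rightarrow> 'a) A"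
  have M: "clinear M" "M (a \<otimes>\<^sub>t b) = a \<otimes>\<^sub>t A b" for a b
    using clinear_tensor_map[OF id A(1)] tensor_map_tensor_of[OF id A(1)] by (simp_all add: M_def)
  have "t = 0" if "M t = 0" for t
  proof (rule ccontr)
    assume "t \<noteq> 0"
    then obtain f :: "'a \<Rightarrow> complex" and g where fg: "clinear f" "clinear g" "f (slice_left g t) \<noteq> 0"
      by (rule tensor_functionals_nonzero)
    have "slice_right f (M t) = A (slice_right f t)"
      by (rule tensor_linear_eqI)
        (simp_all add: clinear_compose clinear_slices bilinear_slices fg M A clinear_scale)
    then have "A (slice_right f t) = 0"
      using that by (simp add: clinear_zero[OF clinear_slices(2)[OF fg(1)]])
    then have "slice_right f t = 0"
      using A by (metis clinear_zero injD)
    then show False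
      using fg by (simp add: slice_commute clinear_zero)
  qed
  then show ?thesis
    unfolding M_def[symmetric] complex_vector.linear_inj_iff_eq_0[OF M(1)] by blast
qed

section \<open>Homomorphisms of modules\<close>

text \<open>
  Schur's lemma: the kernel and the range are submodules.
\<close>

lemma simple_module_hom_bij:
  assumes "\<forall>a\<in>S. clinear (\<alpha> a)" "\<forall>a\<in>S. clinear (\<beta> a)"
    and "simple_module S \<alpha>" "simple_module S \<beta>"
    and h: "clinear h" "\<And>a m. a \<in> S \<Longrightarrow> h (\<alpha> a m) = \<beta> a (h m)" and nz: "h m0 \<noteq> 0"
  shows "bij h"
proof -
  have "submodule S \<alpha> {m. h m = 0}"
    using assms(1,2) unfolding submodule_def complex_vector.subspace_def
    by (auto simp: clinear_add[OF h(1)] clinear_scale[OF h(1)] clinear_zero[OF h(1)] h(2) clinear_zero)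
  then have "{m. h m = 0} = {0}"
    using assms(3) nz unfolding simple_module_def by blast
  then have "inj h"
    unfolding complex_vector.linear_inj_iff_eq_0[OF h(1)] by blast
  have "submodule S \<beta> (range h)"
    unfolding submodule_def
    by (auto simp: h(2)[symmetric] intro!: complex_vector.linear_subspace_image[OF h(1)] complex_vector.subspace_UNIV)
  then have "range h = UNIV"
    using assms(4) nz unfolding simple_module_def by blast
  with \<open>inj h\<close> show ?thesis unfolding bij_def by blast
qed

lemma weyl_generators_induct:
  assumes one: "Q 1" and add: "\<And>a b. Q a \<Longrightarrow> Q b \<Longrightarrow> Q (a + b)" and scale: "\<And>c a. Q a \<Longrightarrow> Q (c *\<^sub>C a)"
    and x: "\<And>a. Q a \<Longrightarrow> Q (weyl_x * a)" and d: "\<And>a. Q a \<Longrightarrow> Q (weyl_d * a)"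
  shows "Q a"
proof (induction a rule: weyl.abs_induct)
  case (1 p)
  show ?case
  proof (induction p rule: poly_mapping_single_induct)
    case (single w c)
    obtain u where w: "w = Word u" by (cases w)
    have "Q (abs_weyl (Poly_Mapping.single (Word u) 1))"
    proof (induction u)
      case Nil
      have "abs_weyl (Poly_Mapping.single (Word []) 1) = 1"
        by (simp add: zero_weyl_word_def[symmetric] one_weyl.abs_eq)
      then show ?case using one by simp
    next
      case (Cons z u)
      have "Poly_Mapping.single (Word (z # u)) 1 = free_letter z * Poly_Mapping.single (Word u) (1::complex)"
        by (simp add: free_letter_def mult_single)
      then have "abs_weyl (Poly_Mapping.single (Word (z # u)) 1)
          = abs_weyl (free_letter z) * abs_weyl (Poly_Mapping.single (Word u) 1)"
        by (simp add: times_weyl.abs_eq)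
      then show ?case
        using Cons x d by (cases z) (simp_all add: weyl_x.abs_eq weyl_d.abs_eq)
    qed
    moreover have "abs_weyl (Poly_Mapping.single w c) = c *\<^sub>C abs_weyl (Poly_Mapping.single w 1)"
      by (simp add: scaleC_weyl.abs_eq scaleC_single)
    ultimately show ?case using scale w by simp
  next
    case (add p q)
    then show ?case using assms(2) by (simp add: plus_weyl.abs_eq[symmetric])
  qed
qed

lemma algebra_module_hom_weyl:
  assumes "algebra_module \<alpha>" "algebra_module \<beta>" and h: "clinear h"
    and x: "\<And>m. h (\<alpha> weyl_x m) = \<beta> weyl_x (h m)" and d: "\<And>m. h (\<alpha> weyl_d m) = \<beta> weyl_d (h m)"
  shows "h (\<alpha> a m) = \<beta> a (h m)"
proof (induction a arbitrary: m rule: weyl_generators_induct)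
qed (use assms(1,2)[unfolded algebra_module_def] x d in
    \<open>simp_all add: clinear_add[OF h] clinear_scale[OF h]\<close>)

lemma lie_module_hom_witt_b:
  assumes "lie_module witt_b \<rho>" "lie_module witt_b \<sigma>" and h: "clinear h"
    and d: "\<And>i m. i \<ge> 0 \<Longrightarrow> h (\<rho> (witt_d i) m) = \<sigma> (witt_d i) (h m)"
    and "w \<in> witt_b"
  shows "h (\<rho> w m) = \<sigma> w (h m)"
proof -
  note L = assms(1,2)[unfolded lie_module_def]
  have sub: "csubspace witt_b" unfolding witt_b_def by simp
  have z: "\<rho> 0 m = 0" "\<sigma> 0 m' = 0" for m m'
    using L complex_vector.subspace_0[OF sub] by (metis complex_vector.scale_zero_left)+
  have sub': "csubspace {w \<in> witt_b. \<forall>m. h (\<rho> w m) = \<sigma> w (h m)}"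
    using sub L unfolding complex_vector.subspace_def
    by (auto simp: z clinear_zero[OF h] clinear_add[OF h] clinear_scale[OF h])
  have "{witt_d i |i. 0 \<le> i} \<subseteq> {w \<in> witt_b. \<forall>m. h (\<rho> w m) = \<sigma> w (h m)}"
    using d by (auto simp: witt_b_def intro: complex_vector.span_base)
  from complex_vector.span_minimal[OF this sub'] show ?thesis
    using assms(5) unfolding witt_b_def by blast
qed

section \<open>The modules \<open>T(P, V)\<close> as families of jets\<close>

locale T_module =
  fixes \<alpha> :: "weyl \<Rightarrow> 'p::complex_vector \<Rightarrow> 'p" and \<rho> :: "witt \<Rightarrow> 'v::complex_vector \<Rightarrow> 'v"
  assumes algebra_module: "algebra_module \<alpha>" and lie_module: "lie_module witt_b \<rho>"
begin

definition X :: "('p, 'v) tensor \<Rightarrow> ('p, 'v) tensor" where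
  "X = tensor_map (\<alpha> weyl_x) id"

definition \<delta> :: "nat \<Rightarrow> ('p, 'v) tensor \<Rightarrow> ('p, 'v) tensor" where
  "\<delta> R = (case R of 0 \<Rightarrow> tensor_map (\<alpha> weyl_d) id | Suc r \<Rightarrow> tensor_map id (\<rho> (witt_d (int r))))"

lemma clinear_\<alpha>: "clinear (\<alpha> a)"
  using algebra_module unfolding algebra_module_def by blast

lemma witt_d_mem: "i \<ge> 0 \<Longrightarrow> witt_d i \<in> witt_b"
  unfolding witt_b_def by (rule complex_vector.span_base) blast

lemma clinear_\<rho>: "i \<ge> 0 \<Longrightarrow> clinear (\<rho> (witt_d i))"
  using lie_module witt_d_mem unfolding lie_module_def by blast

lemma clinear_id: "clinear id"
  by (rule clinearI) simp_all

lemmas clinear_ops = clinear_\<alpha> clinear_\<rho> clinear_id clinear_tensor_map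

lemma X_tensor_of: "X (p \<otimes>\<^sub>t v) = \<alpha> weyl_x p \<otimes>\<^sub>t v"
  by (simp only: X_def tensor_map_tensor_of clinear_ops id_apply)

lemma \<delta>_tensor_of:
  "\<delta> 0 (p \<otimes>\<^sub>t v) = \<alpha> weyl_d p \<otimes>\<^sub>t v" "\<delta> (Suc r) (p \<otimes>\<^sub>t v) = p \<otimes>\<^sub>t \<rho> (witt_d (int r)) v"
  by (simp_all only: \<delta>_def nat.case tensor_map_tensor_of clinear_ops id_apply of_nat_0_le_iff)

lemma clinear_X_\<delta>: "clinear X" "clinear (\<delta> R)"
  by (cases R; simp only: X_def \<delta>_def nat.case clinear_ops of_nat_0_le_iff)+

sublocale jet_operators X \<delta>
proof (rule jet_operators.intro)
  have "\<alpha> (weyl_d * weyl_x) p = \<alpha> (weyl_x * weyl_d + 1) p" for p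
    using weyl_relation by (simp add: algebra_simps)
  then have weyl: "\<alpha> weyl_d (\<alpha> weyl_x p) = \<alpha> weyl_x (\<alpha> weyl_d p) + p" for p
    using algebra_module unfolding algebra_module_def by metis
  fix R t
  show "\<delta> R (X t) = X (\<delta> R t) + (if R = 0 then t else 0)"
  proof (cases R)
    case 0
    show ?thesis
      unfolding 0
      by (rule tensor_linear_eqI)
        (auto intro!: clinearI simp: clinear_X_\<delta>[THEN clinear_add] clinear_X_\<delta>[THEN clinear_scale]
          scaleC_add_right X_tensor_of \<delta>_tensor_of weyl tensor_of_add_left)
  next
    case (Suc r)
    have "\<delta> R (X t) = X (\<delta> R t)"
      unfolding Suc
      by (rule tensor_linear_eqI)
        (auto intro!: clinearI simp: clinear_X_\<delta>[THEN clinear_add] clinear_X_\<delta>[THEN clinear_scale]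
          X_tensor_of \<delta>_tensor_of)
    then show ?thesis using Suc by simp
  qed
qed (rule clinear_X_\<delta>)+

lemma X_pow_tensor_of: "(X ^^ n) (p \<otimes>\<^sub>t v) = \<alpha> (weyl_x ^ n) p \<otimes>\<^sub>t v"
  using algebra_module unfolding algebra_module_def
  by (induction n) (simp_all add: X_tensor_of)

lemma T_basis_eq_jet:
  assumes "m \<ge> -1"
  shows "T_basis \<alpha> \<rho> m t = jet (nat (m + 1)) t"
proof (cases "m = -1")
  case True
  then show ?thesis
    by (simp add: T_basis_def jet_def \<delta>_def scaleC_one)
next
  case False
  define n where "n = nat m"
  have m: "nat m = n" "nat (m + 1) = Suc n" using False \<open>m \<ge> -1\<close> by (simp_all add: n_def)
  have x: "tensor_map (\<alpha> (weyl_x ^ Suc n * weyl_d)) id t = (X ^^ Suc n) (\<delta> 0 t)"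
  proof (rule tensor_linear_eqI[where k = "\<lambda>t. (X ^^ Suc n) (\<delta> 0 t)"])
    show "clinear (\<lambda>t. (X ^^ Suc n) (\<delta> 0 t))"
      by (rule clinear_compose[OF clinear_\<delta> clinear_X_pow])
    show "tensor_map (\<alpha> (weyl_x ^ Suc n * weyl_d)) id (p \<otimes>\<^sub>t v) = (X ^^ Suc n) (\<delta> 0 (p \<otimes>\<^sub>t v))" for p v
      using algebra_module unfolding algebra_module_def
      by (simp only: X_pow_tensor_of \<delta>_tensor_of tensor_map_tensor_of clinear_ops id_apply)
  qed (simp only: clinear_ops)
  have r: "tensor_map (\<alpha> (weyl_x ^ (n - r))) (\<rho> (witt_d (int r))) t = (X ^^ (n - r)) (\<delta> (Suc r) t)" for r
  proof (rule tensor_linear_eqI[where k = "\<lambda>t. (X ^^ (n - r)) (\<delta> (Suc r) t)"])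
    show "clinear (\<lambda>t. (X ^^ (n - r)) (\<delta> (Suc r) t))"
      by (rule clinear_compose[OF clinear_\<delta> clinear_X_pow])
    show "tensor_map (\<alpha> (weyl_x ^ (n - r))) (\<rho> (witt_d (int r))) (p \<otimes>\<^sub>t v)
        = (X ^^ (n - r)) (\<delta> (Suc r) (p \<otimes>\<^sub>t v))" for p v
      by (simp only: X_pow_tensor_of \<delta>_tensor_of tensor_map_tensor_of clinear_ops of_nat_0_le_iff)
  qed (simp only: clinear_ops of_nat_0_le_iff)
  have "T_basis \<alpha> \<rho> m t = (X ^^ Suc n) (\<delta> 0 t)
      + (\<Sum>r = 0..n. of_nat (Suc n choose Suc r) *\<^sub>C (X ^^ (n - r)) (\<delta> (Suc r) t))"
    using False unfolding T_basis_def m by (simp only: if_False x r Suc_eq_plus1[symmetric])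
  also have "\<dots> = jet (Suc n) t"
    unfolding jet_def by (subst sum.atMost_Suc_shift) (simp add: scaleC_one atLeast0AtMost)
  finally show ?thesis by (simp add: m)
qed

lemma jet_eq_T_action: "jet M t = T_action \<alpha> \<rho> (witt_d (int M - 1)) t"
  by (simp add: T_action_witt_d T_basis_eq_jet)

lemma \<delta>_Suc_inj: "inj (\<rho> (witt_d (int r))) \<Longrightarrow> inj (\<delta> (Suc r))"
  by (simp only: \<delta>_def nat.case inj_tensor_map_id_left clinear_ops of_nat_0_le_iff)

lemma \<delta>_vanish:
  assumes "\<forall>i>l. \<forall>v. \<rho> (witt_d i) v = 0" "l < int L"
  shows "\<forall>R>L. \<forall>t. \<delta> R t = 0"
proof (intro allI impI)
  fix R t assume "L < R"
  then obtain r where R: "R = Suc r" "L \<le> r" by (cases R) auto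
  show "\<delta> R t = 0"
    unfolding R(1)
    by (rule tensor_linear_eqI) (use R assms in \<open>auto intro: clinear_\<delta> clinearI simp: \<delta>_tensor_of tensor_of_zero\<close>)
qed

end

section \<open>Isomorphisms between the modules \<open>T(P, V)\<close>\<close>

lemma clinear_inv:
  assumes "clinear f" "bij f"
  shows "clinear (inv f)"
  using assms by (intro clinearI)
    (metis bij_inv_eq_iff clinear_add, metis bij_inv_eq_iff clinear_scale)

lemma T_action_functor:
  assumes "T_module \<alpha> \<rho>" "T_module \<alpha>' \<rho>'"
    and "module_isomorphic UNIV \<alpha> \<alpha>'" "module_isomorphic witt_b \<rho> \<rho>'"
  shows "module_isomorphic UNIV (T_action \<alpha> \<rho>) (T_action \<alpha>' \<rho>')"
proof -
  interpret A: T_module \<alpha> \<rho> by fact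
  interpret B: T_module \<alpha>' \<rho>' by fact
  obtain f where f: "clinear f" "bij f" "\<And>a m. f (\<alpha> a m) = \<alpha>' a (f m)"
    using assms(3) unfolding module_isomorphic_def by blast
  obtain g where g: "clinear g" "bij g" "\<And>a m. a \<in> witt_b \<Longrightarrow> g (\<rho> a m) = \<rho>' a (g m)"
    using assms(4) unfolding module_isomorphic_def by blast
  define h where "h = tensor_map f g"
  have h: "clinear h" "h (a \<otimes>\<^sub>t b) = f a \<otimes>\<^sub>t g b" for a b
    using clinear_tensor_map[OF f(1) g(1)] tensor_map_tensor_of[OF f(1) g(1)] by (simp_all add: h_def)
  have inv: "clinear (inv f)" "clinear (inv g)"
    using f g by (simp_all add: clinear_inv)
  define k where "k = tensor_map (inv f) (inv g)"
  have k: "clinear k" "k (a \<otimes>\<^sub>t b) = inv f a \<otimes>\<^sub>t inv g b" for a b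
    using clinear_tensor_map[OF inv] tensor_map_tensor_of[OF inv] by (simp_all add: k_def)
  have id: "clinear (\<lambda>x. x)" by (rule clinearI) simp_all
  have "k (h t) = t" for t
    by (rule tensor_linear_eqI[OF clinear_compose[OF h(1) k(1)] id])
      (simp add: h k f(2) g(2) bij_is_inj)
  moreover have "h (k t) = t" for t
    by (rule tensor_linear_eqI[OF clinear_compose[OF k(1) h(1)] id])
      (simp add: h k f(2) g(2) bij_is_surj surj_f_inv_f)
  ultimately have bij: "bij h"
    by (metis bijI')
  have X: "h (A.X t) = B.X (h t)" for t
    by (rule tensor_linear_eqI)
      (auto intro: clinear_compose h A.clinear_X B.clinear_X simp: A.X_tensor_of B.X_tensor_of h f(3))
  then have Xp: "h ((A.X ^^ n) t) = (B.X ^^ n) (h t)" for n t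
    by (induction n) auto
  have \<delta>: "h (A.\<delta> R t) = B.\<delta> R (h t)" for R t
    by (rule tensor_linear_eqI; cases R)
      (auto intro: clinear_compose h A.clinear_\<delta> B.clinear_\<delta>
        simp: A.\<delta>_tensor_of B.\<delta>_tensor_of h f(3) g(3) A.witt_d_mem)
  have "h (A.jet M t) = B.jet M (h t)" for M t
    by (simp add: A.jet_def B.jet_def complex_vector.linear_sum[OF h(1)] clinear_scale[OF h(1)] Xp \<delta>)
  then have "h (T_action \<alpha> \<rho> w t) = T_action \<alpha>' \<rho>' w (h t)" for w t
    unfolding T_action_def
    by (simp add: complex_vector.linear_sum[OF h(1)] clinear_scale[OF h(1)] A.T_basis_eq_jet B.T_basis_eq_jet)
  then show ?thesis
    unfolding module_isomorphic_def using h(1) bij by blast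
qed

lemma module_isomorphic_sym:
  assumes "module_isomorphic S \<alpha> \<beta>"
  shows "module_isomorphic S \<beta> \<alpha>"
proof -
  obtain f where f: "clinear f" "bij f" "\<And>a m. a \<in> S \<Longrightarrow> f (\<alpha> a m) = \<beta> a (f m)"
    using assms unfolding module_isomorphic_def by blast
  have "inv f (\<beta> a m) = \<alpha> a (inv f m)" if "a \<in> S" for a m
    using f(2) f(3)[OF that] by (metis bij_inv_eq_iff)
  moreover have "clinear (inv f)"
    using f by (simp add: clinear_inv)
  ultimately show ?thesis
    unfolding module_isomorphic_def using bij_imp_bij_inv[OF f(2)] by blast
qed

text \<open>
  The height \<open>l\<close> is an invariant of the Witt module: if \<open>s < l\<close>, the element of the enveloping
  algebra that acts as \<open>1 \<otimes> d\<^sub>l\<^sup>2\<close> on the source acts as zero on the target, although on the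
  source it is injective.
\<close>

lemma T_action_height_le:
  fixes \<alpha> :: "weyl \<Rightarrow> 'p::complex_vector \<Rightarrow> 'p" and \<rho> :: "witt \<Rightarrow> 'v::complex_vector \<Rightarrow> 'v"
  assumes "T_module \<alpha> \<rho>" "T_module \<alpha>' \<rho>'"
    and iso: "module_isomorphic UNIV (T_action \<alpha> \<rho>) (T_action \<alpha>' \<rho>')"
    and p: "p \<noteq> (0::'p)" and v: "v \<noteq> (0::'v)"
    and l: "l > 0" "inj (\<rho> (witt_d l))" "\<forall>i>l. \<forall>v. \<rho> (witt_d i) v = 0"
    and s: "\<forall>i>s. \<forall>v. \<rho>' (witt_d i) v = 0"
  shows "l \<le> s"
proof (rule ccontr)
  assume "\<not> l \<le> s"
  interpret A: T_module \<alpha> \<rho> by fact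
  interpret B: T_module \<alpha>' \<rho>' by fact
  obtain \<psi> where psi: "clinear \<psi>" "bij \<psi>" "\<And>w t. \<psi> (T_action \<alpha> \<rho> w t) = T_action \<alpha>' \<rho>' w (\<psi> t)"
    using iso unfolding module_isomorphic_def by blast
  define n where "n = nat l"
  have n: "l = int n" "1 \<le> n" using l by (simp_all add: n_def)
  have vanish: "\<forall>R>Suc n. \<forall>t. A.\<delta> R t = 0" "\<forall>R>n. \<forall>t. B.\<delta> R t = 0"
    using n s \<open>\<not> l \<le> s\<close> A.\<delta>_vanish[OF l(3), of "Suc n"] B.\<delta>_vanish[OF s, of n] by simp_all
  have "\<psi> (A.\<delta> (Suc n) (A.\<delta> (Suc n) t)) = 0" for t
    using jet_intertwiner_top[OF A.jet_operators_axioms B.jet_operators_axioms psi(1), of "Suc n" 0 t]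
      vanish n psi(3)
    by (simp add: A.jet_eq_T_action B.jet_eq_T_action)
  moreover have "inj (\<lambda>t. \<psi> (A.\<delta> (Suc n) (A.\<delta> (Suc n) t)))"
    using A.\<delta>_Suc_inj[of n] l(2) psi(2) n by (auto simp: inj_def bij_def)
  ultimately have "p \<otimes>\<^sub>t v = 0"
    by (simp add: inj_def)
  then show False using tensor_of_nonzero[OF p v] by blast
qed

text \<open>
  An isomorphism \<open>\<psi>\<close> of Witt modules of equal height commutes with \<open>x \<otimes> 1\<close>, \<open>\<partial> \<otimes> 1\<close> and all
  \<open>1 \<otimes> d\<^sub>r\<close>. Restricting it to \<open>P \<otimes> v\<^sub>0\<close> and slicing with \<open>g\<close> therefore gives a homomorphism
  \<open>P \<rightarrow> P'\<close>; restricting it to \<open>p\<^sub>0 \<otimes> V\<close> and slicing with \<open>f\<close> gives a homomorphism \<open>V \<rightarrow> V'\<close>.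
  A single choice of \<open>f\<close> and \<open>g\<close> with \<open>(f \<otimes> g)(\<psi>(p\<^sub>0 \<otimes> v\<^sub>0)) \<noteq> 0\<close> makes both nonzero, hence
  bijective by simplicity.
\<close>

lemma T_action_iso_factors:
  fixes \<alpha> :: "weyl \<Rightarrow> 'p::complex_vector \<Rightarrow> 'p" and \<alpha>' :: "weyl \<Rightarrow> 'q::complex_vector \<Rightarrow> 'q"
    and \<rho> :: "witt \<Rightarrow> 'v::complex_vector \<Rightarrow> 'v" and \<rho>' :: "witt \<Rightarrow> 'w::complex_vector \<Rightarrow> 'w"
  assumes "T_module \<alpha> \<rho>" "T_module \<alpha>' \<rho>'"
    and iso: "module_isomorphic UNIV (T_action \<alpha> \<rho>) (T_action \<alpha>' \<rho>')"
    and P: "simple_module UNIV \<alpha>" "simple_module UNIV \<alpha>'"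
    and V: "simple_module witt_b \<rho>" "simple_module witt_b \<rho>'"
    and l: "l > 0" "\<forall>i>l. \<forall>v. \<rho> (witt_d i) v = 0" "\<forall>i>l. \<forall>v. \<rho>' (witt_d i) v = 0" "inj (\<rho>' (witt_d l))"
  shows "module_isomorphic UNIV \<alpha> \<alpha>'" "module_isomorphic witt_b \<rho> \<rho>'"
proof -
  interpret A: T_module \<alpha> \<rho> by fact
  interpret B: T_module \<alpha>' \<rho>' by fact
  obtain \<psi> where psi: "clinear \<psi>" "bij \<psi>" "\<And>w t. \<psi> (T_action \<alpha> \<rho> w t) = T_action \<alpha>' \<rho>' w (\<psi> t)"
    using iso unfolding module_isomorphic_def by blast
  define n where "n = nat l"
  have n: "l = int n" "1 \<le> n" using l by (simp_all add: n_def)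
  have vanish: "\<forall>R>Suc n. \<forall>t. A.\<delta> R t = 0" "\<forall>R>Suc n. \<forall>t. B.\<delta> R t = 0"
    using n A.\<delta>_vanish[OF l(2), of "Suc n"] B.\<delta>_vanish[OF l(3), of "Suc n"] by simp_all
  have "inj (B.\<delta> (Suc n))" using B.\<delta>_Suc_inj[of n] l(4) n by simp
  moreover have "\<psi> (A.jet M t) = B.jet M (\<psi> t)" for M t
    by (simp add: A.jet_eq_T_action B.jet_eq_T_action psi(3))
  ultimately have comm: "\<psi> (A.X t) = B.X (\<psi> t)" "\<psi> (A.\<delta> R t) = B.\<delta> R (\<psi> t)" for R t
    using jet_intertwiner[OF A.jet_operators_axioms B.jet_operators_axioms psi(1), of "Suc n"]
      vanish n by auto
  obtain p0 :: 'p where p0: "p0 \<noteq> 0" using P(1) unfolding simple_module_def by auto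
  obtain v0 :: 'v where v0: "v0 \<noteq> 0" using V(1) unfolding simple_module_def by auto
  have "\<psi> (p0 \<otimes>\<^sub>t v0) \<noteq> 0"
    using tensor_of_nonzero[OF p0 v0] psi(1,2) by (metis bij_is_inj clinear_zero injD)
  then obtain f :: "'q \<Rightarrow> complex" and g where
    fg: "clinear f" "clinear g" "f (slice_left g (\<psi> (p0 \<otimes>\<^sub>t v0))) \<noteq> 0"
    by (rule tensor_functionals_nonzero)
  have lin: "clinear (\<lambda>p. p \<otimes>\<^sub>t v)" "clinear (\<lambda>v. p \<otimes>\<^sub>t v)" for p :: 'p and v :: 'v
    using bilinear_tensor_of unfolding bilinear_map_def by blast+
  have sX: "slice_left g (B.X t) = \<alpha>' weyl_x (slice_left g t)" for t
    by (rule tensor_linear_eqI)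
      (simp_all add: clinear_compose clinear_slices bilinear_slices fg B.clinear_X B.clinear_\<alpha>
        B.X_tensor_of clinear_scale)
  have sd: "slice_left g (B.\<delta> 0 t) = \<alpha>' weyl_d (slice_left g t)" for t
    by (rule tensor_linear_eqI)
      (simp_all add: clinear_compose clinear_slices bilinear_slices fg B.clinear_\<delta> B.clinear_\<alpha>
        B.\<delta>_tensor_of clinear_scale)
  have s\<delta>: "slice_right f (B.\<delta> (Suc r) t) = \<rho>' (witt_d (int r)) (slice_right f t)" for r t
    by (rule tensor_linear_eqI)
      (simp_all add: clinear_compose clinear_slices bilinear_slices fg B.clinear_\<delta> B.clinear_\<rho>
        B.\<delta>_tensor_of clinear_scale)
  define h where "h p = slice_left g (\<psi> (p \<otimes>\<^sub>t v0))" for p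
  have h: "clinear h"
    unfolding h_def by (intro clinear_compose[OF _ clinear_slices(1)[OF fg(2)]] clinear_compose[OF lin(1) psi(1)])
  have hom: "h (\<alpha> a p) = \<alpha>' a (h p)" for a p
  proof (rule algebra_module_hom_weyl[OF A.algebra_module B.algebra_module h])
    show "h (\<alpha> weyl_x m) = \<alpha>' weyl_x (h m)" "h (\<alpha> weyl_d m) = \<alpha>' weyl_d (h m)" for m
      using comm(1)[of "m \<otimes>\<^sub>t v0"] comm(2)[of 0 "m \<otimes>\<^sub>t v0"]
      by (simp_all add: h_def A.X_tensor_of A.\<delta>_tensor_of sX sd)
  qed
  have "h p0 \<noteq> 0" using fg(1,3) by (auto simp: h_def clinear_zero)
  then have "bij h"
    using simple_module_hom_bij[of UNIV \<alpha> \<alpha>' h p0] P h hom A.clinear_\<alpha> B.clinear_\<alpha> by blast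
  then show "module_isomorphic UNIV \<alpha> \<alpha>'"
    unfolding module_isomorphic_def using h hom by blast
  define k where "k v = slice_right f (\<psi> (p0 \<otimes>\<^sub>t v))" for v
  have k: "clinear k"
    unfolding k_def by (intro clinear_compose[OF _ clinear_slices(2)[OF fg(1)]] clinear_compose[OF lin(2) psi(1)])
  have hom: "k (\<rho> w v) = \<rho>' w (k v)" if "w \<in> witt_b" for w v
  proof (rule lie_module_hom_witt_b[OF A.lie_module B.lie_module k _ that])
    fix i :: int and m :: 'v
    assume "i \<ge> 0"
    then obtain r where "i = int r" using nonneg_int_cases by blast
    then show "k (\<rho> (witt_d i) m) = \<rho>' (witt_d i) (k m)"
      using comm(2)[of "Suc r" "p0 \<otimes>\<^sub>t m"] by (simp add: k_def A.\<delta>_tensor_of s\<delta>)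
  qed
  have "k v0 \<noteq> 0"
    using fg(3) slice_commute[OF fg(1,2)] clinear_zero[OF fg(2)] by (auto simp: k_def)
  moreover have "\<forall>w\<in>witt_b. clinear (\<rho> w)" "\<forall>w\<in>witt_b. clinear (\<rho>' w)"
    using A.lie_module B.lie_module unfolding lie_module_def by blast+
  ultimately have "bij k"
    using simple_module_hom_bij[of witt_b \<rho> \<rho>' k v0] V k hom by blast
  then show "module_isomorphic witt_b \<rho> \<rho>'"
    unfolding module_isomorphic_def using k hom by blast
qed

theorem theorem4p4:
  fixes \<alpha> :: "weyl \<Rightarrow> 'p::complex_vector \<Rightarrow> 'p"
    and \<alpha>' :: "weyl \<Rightarrow> 'q::complex_vector \<Rightarrow> 'q"
    and \<rho> :: "witt \<Rightarrow> 'v::complex_vector \<Rightarrow> 'v"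
    and \<rho>' :: "witt \<Rightarrow> 'w::complex_vector \<Rightarrow> 'w"
    and l s :: int
  assumes "algebra_module \<alpha>" and "simple_module UNIV \<alpha>"
    and "algebra_module \<alpha>'" and "simple_module UNIV \<alpha>'"
    and "lie_module witt_b \<rho>" and "simple_module witt_b \<rho>"
    and "lie_module witt_b \<rho>'" and "simple_module witt_b \<rho>'"
    and "l > 0" and "inj (\<rho> (witt_d l))" and "\<forall>i>l. \<forall>v. \<rho> (witt_d i) v = 0"
    and "s > 0" and "inj (\<rho>' (witt_d s))" and "\<forall>i>s. \<forall>v. \<rho>' (witt_d i) v = 0"
  shows "module_isomorphic UNIV (T_action \<alpha> \<rho>) (T_action \<alpha>' \<rho>') \<longleftrightarrow>
    module_isomorphic UNIV \<alpha> \<alpha>' \<and> l = s \<and> module_isomorphic witt_b \<rho> \<rho>'"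
proof -
  have T: "T_module \<alpha> \<rho>" "T_module \<alpha>' \<rho>'"
    using assms by (simp_all add: T_module_def)
  obtain p :: 'p and q :: 'q and v :: 'v and w :: 'w
    where nz: "p \<noteq> 0" "q \<noteq> 0" "v \<noteq> 0" "w \<noteq> 0"
    using assms(2,4,6,8) unfolding simple_module_def by fast
  show ?thesis
  proof
    assume iso: "module_isomorphic UNIV (T_action \<alpha> \<rho>) (T_action \<alpha>' \<rho>')"
    have "l \<le> s"
      using T_action_height_le[OF T iso] nz assms(9-14) by blast
    moreover have "s \<le> l"
      using T_action_height_le[OF T(2,1) module_isomorphic_sym[OF iso]] nz assms(9-14) by blast
    ultimately have "l = s" by simp
    then show "module_isomorphic UNIV \<alpha> \<alpha>' \<and> l = s \<and> module_isomorphic witt_b \<rho> \<rho>'"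
      using T_action_iso_factors[OF T iso] assms by blast
  next
    assume "module_isomorphic UNIV \<alpha> \<alpha>' \<and> l = s \<and> module_isomorphic witt_b \<rho> \<rho>'"
    then show "module_isomorphic UNIV (T_action \<alpha> \<rho>) (T_action \<alpha>' \<rho>')"
      using T_action_functor[OF T] by blast
  qed
qed

end
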